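(* Let $n$ be even, let $z\in\{-1,1\}^n$ have exactly $n/2$ entries equal to $+1$ and $n/2$ equal to $-1$, and let $0\le q<p\le1$. Let $\mathcal{G}$ be a random graph on $n$ vertices in which each undirected edge $(i,j)$, $i\ne j$, is present independently with probability $p$ if $z_i=z_j$ and with probability $q$ otherwise. Let $A$ be the adjacency matrix of $\mathcal{G}$ with its diagonal entries set to $\frac{p-q}{2}$, let $J=\mathbf{1}\mathbf{1}^\top-I\in\mathbf{S}^n$, and let $\tilde A=\frac{2}{p-q}\left(A-\frac{p+q}{2}J\right)$. If the signal strength satisfies $$\lambda(p,q)=\frac{p-q}{\sqrt{2(p+q)}}\sqrt{n}\ \ge\ C\sqrt{\log n}$$ for some numerical constant $C>0$, then with high probability the SDP $$\text{maximize }\operatorname{tr}\!\left(\left(A-\tfrac{p+q}{2}J\right)X\right)\quad\text{subject to}\quad\operatorname{diag}(X)=1,\ X\succeq0,\qquad X\in\mathbf{S}^n,$$ is simple with primal solution $zz^\top$, and the dual solution $y_\star$ of the rescaled SDP $$\text{maximize }\operatorname{tr}(\tilde A X)\quad\text{subject to}\quad\operatorname{diag}(X)=1,\ X\succeq0,\qquad X\in\mathbf{S}^n,$$ with slack matrix $Z_\star=-\tilde A-\operatorname{Diag}(y_\star)$, satisfies $\lambda_{n-1}(Z_\star)>cn$ for some numerical constant $c\in(0,1)$.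
   Context: $\mathbf{S}^n$ is the space of real symmetric $n\times n$ matrices with the trace inner product $\langle X,Y\rangle=\operatorname{tr}(X^\top Y)$. Eigenvalues are written in decreasing order $\lambda_1(A)\ge\cdots\ge\lambda_n(A)$, so $\lambda_{n-1}$ is the second smallest. $\operatorname{diag}(X)=1$ means all diagonal entries of $X$ equal $1$; $\operatorname{Diag}(y)$ is the diagonal matrix with diagonal $y$; $\mathbf{1}$ is the all-ones vector. "With high probability" means with probability tending to $1$ as $n\to\infty$. The numerical constants are universal: the claim is that there exist a sufficiently large $C$ and a constant $c\in(0,1)$, independent of $n,p,q,z$, for which it holds. Consider a standard form SDP (P): minimize $\langle C_0,X\rangle$ subject to $\mathcal{A}X=b$, $X\succeq0$, with variable $X\in\mathbf{S}^n$, where $C_0\in\mathbf{S}^n$ is the cost matrix and $[\mathcal{A}X]_i=\langle A_i,X\rangle$ for $i=1,\dots,m$ with fixed $A_i\in\mathbf{S}^n$. Its dual (D) is: maximize $\langle b,y\rangle$ subject to $C_0-\mathcal{A}^*y\succeq0$, with variable $y\in\mathbb{R}^m$, where $\mathcal{A}^*y=\sum_i y_iA_i$; the slack matrix of $y$ is $C_0-\mathcal{A}^*y$. "Solution" means optimal solution. A maximization SDP with objective $\operatorname{tr}(MX)$ is regarded as the minimization SDP with cost matrix $C_0=-M$ (so for the rescaled SDP $C_0=-\tilde A$, $\mathcal{A}=\operatorname{diag}$, $\mathcal{A}^*=\operatorname{Diag}$, $b=\mathbf{1}$). - Strong duality: a primal-dual solution pair exists, and for any solution pair $(X_\star,y_\star)$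 of (P) and (D), $\operatorname{tr}(C_0X_\star)=b^\top y_\star$. - Surjective constraint map: $\mathcal{A}:\mathbf{S}^n\to\mathbb{R}^m$ is surjective, equivalently the matrices $A_i$ are linearly independent. - Strict complementarity: there is a solution pair $(X_\star,y_\star)$ of (P) and (D) with $\operatorname{rank}(X_\star)+\operatorname{rank}(C_0-\mathcal{A}^*y_\star)=n$. - (P) is simple if it satisfies strong duality, has a surjective constraint map, satisfies strict complementarity, and both (P) and (D) have unique solutions. *)

theory Defs
  imports
    "HOL-Probability.Product_PMF"
    "Jordan_Normal_Form.Char_Poly"
    "Jordan_Normal_Form.DL_Rank"
begin

unbundle no vec_syntax
unbundle no inner_syntax
hide_const (open) Finite_Cartesian_Product.vec Finite_Cartesian_Product.mat

definition sym_mats :: "nat \<Rightarrow> real mat set" where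
  "sym_mats n = {X \<in> carrier_mat n n. X\<^sup>T = X}"

definition mat_trace :: "real mat \<Rightarrow> real" where
  "mat_trace X = (\<Sum>i<dim_row X. X $$ (i, i))"

definition trace_inner :: "real mat \<Rightarrow> real mat \<Rightarrow> real" where
  "trace_inner X Y = mat_trace (X\<^sup>T * Y)"

definition psd_mat :: "nat \<Rightarrow> real mat \<Rightarrow> bool" where
  "psd_mat n X \<longleftrightarrow> X \<in> sym_mats n \<and> (\<forall>v \<in> carrier_vec n. 0 \<le> scalar_prod v (X *\<^sub>v v))"

text \<open>The eigenvalues are the roots of the characteristic polynomial, with multiplicity, in
  decreasing order; for a real symmetric matrix of dimension \<open>n\<close> there are exactly \<open>n\<close> of them.
  The index of \<open>eigval\<close> starts at 1.\<close>

definition eigvals_decr :: "real mat \<Rightarrow> real list" where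
  "eigvals_decr X = rev (sorted_list_of_multiset (proots (char_poly X)))"

definition eigval :: "nat \<Rightarrow> real mat \<Rightarrow> real" where
  "eigval k X = eigvals_decr X ! (k - 1)"

record sdp =
  sdp_dim :: nat
  sdp_cost :: "real mat"
  sdp_mats :: "real mat list"
  sdp_rhs :: "real vec"

definition constr_map :: "sdp \<Rightarrow> real mat \<Rightarrow> real vec" where
  "constr_map P X = Matrix.vec (length (sdp_mats P)) (\<lambda>i. trace_inner (sdp_mats P ! i) X)"

definition constr_adj :: "sdp \<Rightarrow> real vec \<Rightarrow> real mat" where
  "constr_adj P y = Matrix.mat (sdp_dim P) (sdp_dim P)
     (\<lambda>(r, s). \<Sum>i<length (sdp_mats P). y $ i * (sdp_mats P ! i) $$ (r, s))"

definition slack :: "sdp \<Rightarrow> real vec \<Rightarrow> real mat" where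
  "slack P y = sdp_cost P - constr_adj P y"

definition primal_feasible :: "sdp \<Rightarrow> real mat \<Rightarrow> bool" where
  "primal_feasible P X \<longleftrightarrow> constr_map P X = sdp_rhs P \<and> psd_mat (sdp_dim P) X"

definition primal_solution :: "sdp \<Rightarrow> real mat \<Rightarrow> bool" where
  "primal_solution P X \<longleftrightarrow> primal_feasible P X \<and>
     (\<forall>X'. primal_feasible P X' \<longrightarrow> trace_inner (sdp_cost P) X \<le> trace_inner (sdp_cost P) X')"

definition dual_feasible :: "sdp \<Rightarrow> real vec \<Rightarrow> bool" where
  "dual_feasible P y \<longleftrightarrow>
     y \<in> carrier_vec (length (sdp_mats P)) \<and> psd_mat (sdp_dim P) (slack P y)"

definition dual_solution :: "sdp \<Rightarrow> real vec \<Rightarrow> bool" where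
  "dual_solution P y \<longleftrightarrow> dual_feasible P y \<and>
     (\<forall>y'. dual_feasible P y' \<longrightarrow> scalar_prod (sdp_rhs P) y' \<le> scalar_prod (sdp_rhs P) y)"

definition strong_duality :: "sdp \<Rightarrow> bool" where
  "strong_duality P \<longleftrightarrow>
     (\<exists>X y. primal_solution P X \<and> dual_solution P y) \<and>
     (\<forall>X y. primal_solution P X \<and> dual_solution P y \<longrightarrow>
        mat_trace (sdp_cost P * X) = scalar_prod (sdp_rhs P) y)"

definition surjective_constr_map :: "sdp \<Rightarrow> bool" where
  "surjective_constr_map P \<longleftrightarrow>
     constr_map P ` sym_mats (sdp_dim P) = carrier_vec (length (sdp_mats P))"

definition strict_complementarity :: "sdp \<Rightarrow> bool" where
  "strict_complementarity P \<longleftrightarrow>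
     (\<exists>X y. primal_solution P X \<and> dual_solution P y \<and>
        vec_space.rank (sdp_dim P) X + vec_space.rank (sdp_dim P) (slack P y) = sdp_dim P)"

definition simple_sdp :: "sdp \<Rightarrow> bool" where
  "simple_sdp P \<longleftrightarrow>
     strong_duality P \<and> surjective_constr_map P \<and> strict_complementarity P \<and>
     (\<exists>!X. primal_solution P X) \<and> (\<exists>!y. dual_solution P y)"

definition diag_of_vec :: "real vec \<Rightarrow> real mat" where
  "diag_of_vec y = mat_diag (dim_vec y) (\<lambda>i. y $ i)"

definition diag_unit_mat :: "nat \<Rightarrow> nat \<Rightarrow> real mat" where
  "diag_unit_mat n i = mat_diag n (\<lambda>j. if j = i then 1 else 0)"

text \<open>Maximize \<open>tr (M X)\<close> subject to \<open>diag X = 1\<close> and \<open>X\<close> positive semidefinite, as a minimization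
  problem with cost matrix \<open>- M\<close>. Lemmas \<open>constr_map_max_diag_sdp\<close> and \<open>slack_max_diag_sdp\<close> below
  give the constraint map and the slack matrix.\<close>

definition max_diag_sdp :: "nat \<Rightarrow> real mat \<Rightarrow> sdp" where
  "max_diag_sdp n M =
     \<lparr>sdp_dim = n, sdp_cost = - M, sdp_mats = map (diag_unit_mat n) [0..<n],
      sdp_rhs = Matrix.vec n (\<lambda>_. 1)\<rparr>"

lemma constr_map_max_diag_sdp:
  assumes "X \<in> carrier_mat n n"
  shows "constr_map (max_diag_sdp n M) X = Matrix.vec n (\<lambda>i. X $$ (i, i))"
proof (rule eq_vecI)
  fix i assume "i < dim_vec (Matrix.vec n (\<lambda>i. X $$ (i, i)))"
  then have i: "i < n" by simp
  have "trace_inner (diag_unit_mat n i) X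
      = (\<Sum>k<n. \<Sum>l\<in>{0..<n}. (if k = i \<and> l = i then X $$ (i, i) else 0))"
    unfolding trace_inner_def mat_trace_def using assms
    by (auto simp: diag_unit_mat_def mat_diag_def scalar_prod_def intro!: sum.cong)
  also have "\<dots> = (\<Sum>k<n. if k = i then X $$ (i, i) else 0)"
    using i by (intro sum.cong) auto
  also have "\<dots> = X $$ (i, i)" using i by simp
  finally show "constr_map (max_diag_sdp n M) X $ i = Matrix.vec n (\<lambda>i. X $$ (i, i)) $ i"
    using i by (simp add: constr_map_def max_diag_sdp_def)
qed (simp add: constr_map_def max_diag_sdp_def)

lemma slack_max_diag_sdp:
  assumes "y \<in> carrier_vec n"
  shows "slack (max_diag_sdp n M) y = - M - diag_of_vec y"
proof -
  have "constr_adj (max_diag_sdp n M) y = diag_of_vec y"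
  proof (rule eq_matI)
    fix r s assume "r < dim_row (diag_of_vec y)" "s < dim_col (diag_of_vec y)"
    then have rs: "r < n" "s < n" using assms by (auto simp: diag_of_vec_def mat_diag_def)
    have "(\<Sum>i<n. y $ i * diag_unit_mat n i $$ (r, s))
        = (\<Sum>i<n. if i = r then (if r = s then y $ r else 0) else 0)"
      using rs by (intro sum.cong) (auto simp: diag_unit_mat_def mat_diag_def)
    also have "\<dots> = (if r = s then y $ r else 0)" using rs by simp
    finally show "constr_adj (max_diag_sdp n M) y $$ (r, s) = diag_of_vec y $$ (r, s)"
      using rs assms by (simp add: constr_adj_def max_diag_sdp_def diag_of_vec_def mat_diag_def)
  qed (use assms in \<open>auto simp: constr_adj_def max_diag_sdp_def diag_of_vec_def mat_diag_def\<close>)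
  then show ?thesis by (simp add: slack_def max_diag_sdp_def)
qed

definition balanced_labels :: "nat \<Rightarrow> real vec \<Rightarrow> bool" where
  "balanced_labels n z \<longleftrightarrow> z \<in> carrier_vec n \<and> (\<forall>i<n. z $ i \<in> {-1, 1}) \<and>
     2 * card {i. i < n \<and> z $ i = 1} = n \<and> 2 * card {i. i < n \<and> z $ i = -1} = n"

definition vertex_pairs :: "nat \<Rightarrow> (nat \<times> nat) set" where
  "vertex_pairs n = {(i, j). i < j \<and> j < n}"

text \<open>The law of the graph on the vertices \<open>{0..<n}\<close>, represented by its set of (two-element)
  edges. There is one independent Bernoulli variable for each pair \<open>i < j\<close>.\<close>

definition block_model :: "nat \<Rightarrow> real vec \<Rightarrow> real \<Rightarrow> real \<Rightarrow> nat set set pmf" where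
  "block_model n z p q =
     map_pmf (\<lambda>f. {{i, j} |i j. (i, j) \<in> vertex_pairs n \<and> f (i, j)})
       (Pi_pmf (vertex_pairs n) False
          (\<lambda>(i, j). bernoulli_pmf (if z $ i = z $ j then p else q)))"

definition adj_mat_with_diag :: "nat \<Rightarrow> real \<Rightarrow> nat set set \<Rightarrow> real mat" where
  "adj_mat_with_diag n d E = Matrix.mat n n
     (\<lambda>(i, j). if i = j then d else if {i, j} \<in> E then 1 else 0)"

definition offdiag_ones :: "nat \<Rightarrow> real mat" where
  "offdiag_ones n = Matrix.mat n n (\<lambda>_. 1) - 1\<^sub>m n"

definition self_outer :: "real vec \<Rightarrow> real mat" where
  "self_outer z = Matrix.mat (dim_vec z) (dim_vec z) (\<lambda>(i, j). z $ i * z $ j)"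

definition signal_strength :: "nat \<Rightarrow> real \<Rightarrow> real \<Rightarrow> real" where
  "signal_strength n p q = (p - q) / sqrt (2 * (p + q)) * sqrt (real n)"

end

theory Submission
  imports
    Defs
    "Jordan_Normal_Form.Schur_Decomposition"
    "HOL-Computational_Algebra.Fundamental_Theorem_Algebra"
begin

text \<open>Write \<open>M = (p - q) / 2 * (z z\<^sup>T) + W\<close> with a centred noise matrix \<open>W\<close>. The only
  candidate for a dual solution is the vector \<open>y\<close> with \<open>y\<^sub>i = - z\<^sub>i (M z)\<^sub>i\<close>; its slack matrix
  \<open>Z\<close> annihilates \<open>z\<close>. If moreover \<open>Z\<close> is at least some \<open>\<mu> > 0\<close> on the orthogonal complement of
  \<open>z\<close>, then complementary slackness determines both solutions, the ranks of \<open>z z\<^sup>T\<close> and \<open>Z\<close> add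
  up to \<open>n\<close>, and the second smallest eigenvalue of \<open>Z\<close> is at least \<open>\<mu>\<close> (locales \<open>gapped_matrix\<close>
  and \<open>certified_labels\<close>). On that complement, \<open>Z = (p - q) n / 2 * I + Diag (z\<^sub>i (W z)\<^sub>i) - W\<close>,
  so it suffices that the signed row sums of \<open>W\<close> and its operator norm are at most
  \<open>T = (p - q) n / 8\<close> (\<open>certified_labels_noise\<close>).

  Both are at most of order \<open>sqrt (n p ln n)\<close> with high probability, by moments of order
  \<open>2 k\<close> with \<open>k\<close> of order \<open>ln n\<close>. The entries of \<open>W ^ (2 k)\<close> and the powers \<open>(W z)\<^sub>i ^ (2 k)\<close>
  are sums over walks of products of \<open>2 k\<close> centred Bernoulli variables. Such a product has
  expectation \<open>0\<close> unless each of its variables is repeated, and counting walks by their distinct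
  edges gives the bound \<open>(8 k n p) ^ k\<close> whenever \<open>2 k \<le> n p\<close> (\<open>walk_moment_le\<close>). The logarithm
  lost in comparison with the sharp order \<open>sqrt (n p)\<close> of the norm is the one that the signal
  strength condition allows. The Markov inequality concludes (\<open>noise_stat_tail\<close>), with the
  operator norm bounded by the trace of \<open>W ^ (2 k)\<close> (\<open>quadratic_form_le_trace_power\<close>).\<close>

section \<open>Vectors and symmetric matrices in coordinates\<close>

lemma scalar_prod_sum:
  "w \<in> carrier_vec n \<Longrightarrow> v \<bullet> w = (\<Sum>i<n. v $ i * w $ i)"
  by (simp add: scalar_prod_def atLeast0LessThan)

lemma mult_mat_vec_sum:
  "A \<in> carrier_mat n n \<Longrightarrow> v \<in> carrier_vec n \<Longrightarrow> i < n \<Longrightarrow> (A *\<^sub>v v) $ i = (\<Sum>j<n. A $$ (i, j) * v $ j)"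
  by (simp add: scalar_prod_def atLeast0LessThan)

lemma bilinear_sum:
  "A \<in> carrier_mat n n \<Longrightarrow> v \<in> carrier_vec n \<Longrightarrow> w \<bullet> (A *\<^sub>v v) = (\<Sum>i<n. \<Sum>j<n. w $ i * A $$ (i, j) * v $ j)"
  by (subst scalar_prod_sum[of _ n]) (auto simp: mult_mat_vec_sum sum_distrib_left mult.assoc
        simp del: index_mult_mat_vec intro!: sum.cong)

lemma sym_mats_carrier: "A \<in> sym_mats n \<Longrightarrow> A \<in> carrier_mat n n"
  by (simp add: sym_mats_def)

lemma sym_mats_index: "A \<in> sym_mats n \<Longrightarrow> i < n \<Longrightarrow> j < n \<Longrightarrow> A $$ (i, j) = A $$ (j, i)"
  using index_transpose_mat(1)[of i A j] by (auto simp: sym_mats_def)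

lemma sym_matsI:
  assumes "A \<in> carrier_mat n n" "\<And>i j. i < n \<Longrightarrow> j < n \<Longrightarrow> A $$ (i, j) = A $$ (j, i)"
  shows "A \<in> sym_mats n"
  using assms by (auto simp: sym_mats_def)

lemma sym_mats_adjoint:
  assumes "A \<in> sym_mats n" "v \<in> carrier_vec n" "w \<in> carrier_vec n"
  shows "(A *\<^sub>v v) \<bullet> w = v \<bullet> (A *\<^sub>v w)"
  using transpose_vec_mult_scalar[of A n n w v] assms by (simp add: sym_mats_def)

lemma self_outer_carrier: "z \<in> carrier_vec n \<Longrightarrow> self_outer z \<in> carrier_mat n n"
  by (auto simp: self_outer_def)

lemma self_outer_form:
  assumes "z \<in> carrier_vec n" "v \<in> carrier_vec n"
  shows "v \<bullet> (self_outer z *\<^sub>v v) = (z \<bullet> v)\<^sup>2"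
proof -
  have "v \<bullet> (self_outer z *\<^sub>v v) = (\<Sum>i<n. \<Sum>j<n. (z $ i * v $ i) * (z $ j * v $ j))"
    unfolding bilinear_sum[OF self_outer_carrier[OF assms(1)] assms(2)] using assms(1)
    by (intro sum.cong refl) (auto simp: self_outer_def)
  also have "\<dots> = (z \<bullet> v)\<^sup>2"
    using assms(2) by (simp add: scalar_prod_sum[of _ n] sum_product power2_eq_square)
  finally show ?thesis .
qed

lemma scalar_prod_self_nonneg: "0 \<le> v \<bullet> (v :: real vec)"
  by (simp add: scalar_prod_def sum_nonneg)

lemma scalar_prod_self_eq_0:
  assumes "v \<in> carrier_vec n" "v \<bullet> (v :: real vec) = 0"
  shows "v = 0\<^sub>v n"
proof -
  have "(\<Sum>i<n. v $ i * v $ i) = 0" using assms scalar_prod_sum by metis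
  then have "\<forall>i<n. v $ i = 0" by (subst (asm) sum_nonneg_eq_0_iff) auto
  then show ?thesis using assms by (intro eq_vecI) auto
qed

section \<open>Real spectrum of a symmetric matrix\<close>

lemma real_poly_splits:
  fixes p :: "real poly"
  assumes "p \<noteq> 0" "\<And>x. poly (map_poly complex_of_real p) x = 0 \<Longrightarrow> x \<in> \<real>"
  shows "p = Polynomial.smult (lead_coeff p) (\<Prod>x\<in>#proots p. [:- x, 1:])"
  using assms
proof (induction "degree p" arbitrary: p)
  case 0
  then obtain c where c: "p = [:c:]" by (metis degree_eq_zeroE)
  then have "proots p = {#}" using 0 by (intro multiset_eqI) (simp add: order_0I)
  then show ?case using c by simp
next
  case (Suc d)
  have "degree (map_poly complex_of_real p) = Suc d"
    using Suc.hyps by (simp add: degree_map_poly)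
  then obtain x where x: "poly (map_poly complex_of_real p) x = 0"
    using fundamental_theorem_of_algebra[of "map_poly complex_of_real p"] constant_degree
    by (metis nat.distinct(1))
  then obtain a where a: "x = complex_of_real a" using Suc.prems Reals_cases by metis
  have "poly p a = 0" using x unfolding a of_real_hom.poly_map_poly by simp
  then obtain q where q: "p = [:- a, 1:] * q" by (auto simp: poly_eq_0_iff_dvd dvd_def)
  have q0: "q \<noteq> 0" using Suc.prems q by auto
  have "degree p = Suc (degree q)" unfolding q using q0 by (subst degree_mult_eq) auto
  then have dq: "d = degree q" using Suc.hyps by simp
  interpret mp: map_poly_comm_ring_hom complex_of_real ..
  have "y \<in> \<real>" if "poly (map_poly complex_of_real q) y = 0" for y
    using Suc.prems(2)[of y] that by (simp only: q mp.hom_mult poly_mult) simp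
  then have "q = Polynomial.smult (lead_coeff q) (\<Prod>x\<in>#proots q. [:- x, 1:])"
    using Suc.hyps(1)[OF dq q0] by simp
  moreover have "lead_coeff p = lead_coeff q" unfolding q by (subst lead_coeff_mult) simp
  moreover have "proots p = add_mset a (proots q)"
    unfolding q using q0 by (subst proots_mult) auto
  ultimately show ?case
    by (simp only: image_mset_add_mset prod_mset.add_mset)
      (metis q Polynomial.mult_smult_right)
qed

lemma real_sym_eigenvalue_real:
  assumes A: "A \<in> sym_mats n" and ev: "eigenvalue (map_mat complex_of_real A) x"
  shows "x \<in> \<real>"
proof -
  have cA: "A \<in> carrier_mat n n" using A by (rule sym_mats_carrier)
  then have cC: "map_mat complex_of_real A \<in> carrier_mat n n" by simp
  obtain v where v: "v \<in> carrier_vec n" "v \<noteq> 0\<^sub>v n" "map_mat complex_of_real A *\<^sub>v v = x \<cdot>\<^sub>v v"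
    using ev cA unfolding eigenvalue_def eigenvector_def by auto
  have row: "(\<Sum>j<n. complex_of_real (A $$ (i, j)) * v $ j) = x * v $ i" if "i < n" for i
    using mult_mat_vec_sum[OF cC v(1) that] v cA that by simp
  define S where "S = (\<Sum>i<n. \<Sum>j<n. cnj (v $ i) * complex_of_real (A $$ (i, j)) * v $ j)"
  define N where "N = (\<Sum>i<n. (cmod (v $ i))\<^sup>2)"
  have "S = (\<Sum>i<n. cnj (v $ i) * (x * v $ i))"
    unfolding S_def by (intro sum.cong refl) (simp add: row[symmetric] sum_distrib_left mult.assoc)
  also have "\<dots> = x * (\<Sum>i<n. v $ i * cnj (v $ i))" by (simp add: sum_distrib_left mult_ac)
  also have "(\<Sum>i<n. v $ i * cnj (v $ i)) = complex_of_real N"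
    by (simp add: N_def complex_mult_cnj cmod_power2)
  finally have SN: "S = x * complex_of_real N" .
  have "cnj S = (\<Sum>i<n. \<Sum>j<n. v $ i * complex_of_real (A $$ (i, j)) * cnj (v $ j))"
    by (simp add: S_def)
  also have "\<dots> = (\<Sum>j<n. \<Sum>i<n. v $ i * complex_of_real (A $$ (i, j)) * cnj (v $ j))"
    by (rule sum.swap)
  also have "\<dots> = S" unfolding S_def
    by (intro sum.cong refl) (auto simp: sym_mats_index[OF A] mult_ac)
  finally have "S \<in> \<real>" by (simp add: Reals_cnj_iff)
  moreover have "N \<noteq> 0"
  proof
    assume "N = 0"
    then have "\<forall>i<n. v $ i = 0" unfolding N_def by (subst (asm) sum_nonneg_eq_0_iff) auto
    then show False using v(1,2) eq_vecI[of v "0\<^sub>v n"] by auto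
  qed
  ultimately have "S / complex_of_real N \<in> \<real>" by (intro Reals_divide) auto
  then show ?thesis using SN \<open>N \<noteq> 0\<close> by simp
qed

lemma char_poly_real_sym:
  assumes A: "A \<in> sym_mats n"
  shows "char_poly A = (\<Prod>x\<in>#proots (char_poly A). [:- x, 1:])" "size (proots (char_poly A)) = n"
proof -
  have cA: "A \<in> carrier_mat n n" using A by (rule sym_mats_carrier)
  note mon = degree_monic_char_poly[OF cA]
  then have nz: "char_poly A \<noteq> 0" by auto
  have "x \<in> \<real>" if "poly (map_poly complex_of_real (char_poly A)) x = 0" for x
    using that real_sym_eigenvalue_real[OF A]
      eigenvalue_root_char_poly[of "map_mat complex_of_real A" n x] cA
    by (simp add: of_real_hom.char_poly_hom[OF cA])
  from real_poly_splits[OF nz this] mon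
  show *: "char_poly A = (\<Prod>x\<in>#proots (char_poly A). [:- x, 1:])" by simp
  have deg: "degree (\<Prod>x\<in>#M. [:- x, 1:]) = size M" for M :: "real multiset"
  proof (induction M)
    case (add x M)
    have "(\<Prod>x\<in>#M. [:- x, 1:]) \<noteq> 0" by (auto simp: prod_mset_zero_iff)
    then show ?case using add by (simp del: mult_pCons_left add: degree_mult_eq)
  qed simp
  show "size (proots (char_poly A)) = n" using mon deg * by metis
qed

section \<open>Symmetric matrices with a one-dimensional kernel and a gap\<close>

text \<open>A symmetric matrix \<open>Z\<close> that annihilates \<open>z\<close> and whose quadratic form is at least \<open>\<mu> > 0\<close>
  times the squared norm on the orthogonal complement of \<open>z\<close>. The normalisation \<open>z \<bullet> z = n\<close> is
  that of a sign vector.\<close>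

locale gapped_matrix =
  fixes n :: nat and Z :: "real mat" and z :: "real vec" and \<mu> :: real
  assumes Z: "Z \<in> sym_mats n" and z: "z \<in> carrier_vec n" and Zz: "Z *\<^sub>v z = 0\<^sub>v n"
    and z_norm: "z \<bullet> z = real n" and \<mu>: "\<mu> > 0" and n2: "n \<ge> 2"
    and form: "\<And>v. v \<in> carrier_vec n \<Longrightarrow> z \<bullet> v = 0 \<Longrightarrow> v \<bullet> (Z *\<^sub>v v) \<ge> \<mu> * (v \<bullet> v)"
begin

lemma cZ: "Z \<in> carrier_mat n n" using Z by (rule sym_mats_carrier)

text \<open>The quantity \<open>v \<bullet> v - (z \<bullet> v)\<^sup>2 / n\<close> is the squared norm of the component of \<open>v\<close>
  orthogonal to \<open>z\<close>.\<close>

lemma form_general: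
  assumes v: "v \<in> carrier_vec n"
  shows "v \<bullet> (Z *\<^sub>v v) \<ge> \<mu> * (v \<bullet> v - (z \<bullet> v)\<^sup>2 / n)"
    and "v \<bullet> v - (z \<bullet> v)\<^sup>2 / n \<ge> 0"
    and "v \<bullet> v - (z \<bullet> v)\<^sup>2 / n = 0 \<Longrightarrow> v = (z \<bullet> v / n) \<cdot>\<^sub>v z"
proof -
  define c where "c = z \<bullet> v / n"
  define u where "u = v - c \<cdot>\<^sub>v z"
  have n0: "n > 0" using n2 by simp
  have u: "u \<in> carrier_vec n" using v z by (simp add: u_def)
  have zv: "v \<bullet> z = z \<bullet> v" using v z by (rule comm_scalar_prod)
  have zu: "z \<bullet> u = 0"
    using v z n0 by (simp add: u_def scalar_prod_minus_distrib[of _ n] z_norm c_def)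
  have "u \<bullet> u = v \<bullet> u - c * (z \<bullet> u)"
    using v z u by (subst (1) u_def) (simp add: minus_scalar_prod_distrib[of _ n])
  also have "\<dots> = v \<bullet> v - c * (z \<bullet> v)"
    using v z zu by (simp add: u_def scalar_prod_minus_distrib[of _ n] zv)
  finally have uu: "u \<bullet> u = v \<bullet> v - (z \<bullet> v)\<^sup>2 / n" by (simp add: c_def power2_eq_square)
  have Zu: "Z *\<^sub>v u = Z *\<^sub>v v"
    using v z cZ
    by (auto simp: u_def mult_minus_distrib_mat_vec[of _ n n] mult_mat_vec[of _ n n] Zz intro!: eq_vecI)
  have "u \<bullet> (Z *\<^sub>v u) = v \<bullet> (Z *\<^sub>v v) - c * (z \<bullet> (Z *\<^sub>v v))"
    unfolding Zu using v z cZ by (simp add: u_def minus_scalar_prod_distrib[of _ n])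
  also have "z \<bullet> (Z *\<^sub>v v) = 0"
    using sym_mats_adjoint[OF Z z v] Zz v by simp
  finally show "v \<bullet> (Z *\<^sub>v v) \<ge> \<mu> * (v \<bullet> v - (z \<bullet> v)\<^sup>2 / n)"
    using form[OF u zu] uu by simp
  show "v \<bullet> v - (z \<bullet> v)\<^sup>2 / n \<ge> 0" using uu scalar_prod_self_nonneg by metis
  assume "v \<bullet> v - (z \<bullet> v)\<^sup>2 / n = 0"
  then have "u = 0\<^sub>v n" using uu scalar_prod_self_eq_0[OF u] by simp
  then have "u $ i = 0" if "i < n" for i using that by simp
  moreover have "u $ i = v $ i - c * z $ i" if "i < n" for i
    using that v z by (simp add: u_def)
  ultimately show "v = (z \<bullet> v / n) \<cdot>\<^sub>v z" unfolding c_def using v z by (intro eq_vecI) auto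
qed

lemma kernel:
  assumes v: "v \<in> carrier_vec n" and "Z *\<^sub>v v = 0\<^sub>v n"
  shows "v = (z \<bullet> v / n) \<cdot>\<^sub>v z"
proof (rule form_general(3)[OF v])
  have "\<mu> * (v \<bullet> v - (z \<bullet> v)\<^sup>2 / n) \<le> 0" using form_general(1)[OF v] assms by simp
  then show "v \<bullet> v - (z \<bullet> v)\<^sup>2 / n = 0"
    using form_general(2)[OF v] \<mu> by (simp add: mult_le_0_iff)
qed

lemma psd: "psd_mat n Z"
  unfolding psd_mat_def
proof (intro conjI ballI Z)
  fix v :: "real vec" assume v: "v \<in> carrier_vec n"
  have "0 \<le> \<mu> * (v \<bullet> v - (z \<bullet> v)\<^sup>2 / n)" using form_general(2)[OF v] \<mu> by simp
  then show "0 \<le> v \<bullet> (Z *\<^sub>v v)" using form_general(1)[OF v] by linarith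
qed

lemma eigenvalue_cases:
  assumes "eigenvalue Z x"
  shows "x = 0 \<or> x \<ge> \<mu>"
proof (rule disjCI)
  assume x: "\<not> x \<ge> \<mu>"
  obtain v where v: "v \<in> carrier_vec n" "v \<noteq> 0\<^sub>v n" "Z *\<^sub>v v = x \<cdot>\<^sub>v v"
    using assms cZ unfolding eigenvalue_def eigenvector_def by auto
  have "x * (z \<bullet> v) = z \<bullet> (Z *\<^sub>v v)" using v z by simp
  also have "\<dots> = 0" using sym_mats_adjoint[OF Z z v(1)] Zz v by simp
  finally consider "x = 0" | "z \<bullet> v = 0" by auto
  then show "x = 0"
  proof cases
    case 2
    have "\<mu> * (v \<bullet> v) \<le> x * (v \<bullet> v)" using form[OF v(1) 2] v by simp
    moreover have "v \<bullet> v > 0"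
      using scalar_prod_self_nonneg[of v] scalar_prod_self_eq_0[OF v(1)] v(2) by fastforce
    ultimately show ?thesis using x by simp
  qed
qed

text \<open>All eigenvalues are \<open>0\<close> or at least \<open>\<mu>\<close>, so the claim is that \<open>0\<close> is a simple root of
  the characteristic polynomial. If it were a double root, a Schur triangularisation listing the
  eigenvalues in increasing order would start with two zeros on the diagonal; its first two
  basis vectors \<open>c0\<close>, \<open>c1\<close> satisfy \<open>Z c0 = 0\<close> and \<open>Z (Z c1) = 0\<close>, hence \<open>Z c1 = 0\<close> by symmetry,
  which gives two independent vectors in a one-dimensional kernel.\<close>

lemma second_smallest_eigenvalue: "eigval (n - 1) Z \<ge> \<mu>"
proof (rule ccontr)
  assume less: "\<not> eigval (n - 1) Z \<ge> \<mu>"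
  define es where "es = sorted_list_of_multiset (proots (char_poly Z))"
  have mes: "mset es = proots (char_poly Z)" by (simp add: es_def)
  have len: "length es = n" using char_poly_real_sym(2)[OF Z] mes by (metis size_mset)
  have srt: "sorted es" by (simp add: es_def)
  have "char_poly Z = (\<Prod>x\<in>#mset es. [:- x, 1:])"
    using char_poly_real_sym(1)[OF Z] mes by simp
  then have cp: "char_poly Z = (\<Prod>e\<leftarrow>es. [:- e, 1:])"
    by (metis mset_map prod_mset_prod_list)
  have "char_poly Z \<noteq> 0" using degree_monic_char_poly[OF cZ] by auto
  then have ev: "eigenvalue Z e" if "e \<in> set es" for e
    using that mes eigenvalue_root_char_poly[OF cZ]
    by (simp flip: set_mset_mset)
  have "eigval (n - 1) Z = rev es ! (n - 2)"
    by (simp add: eigval_def eigvals_decr_def es_def numeral_2_eq_2)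
  also have "\<dots> = es ! 1" using n2 len by (simp add: rev_nth numeral_2_eq_2 Suc_diff_Suc)
  finally have e1: "es ! 1 < \<mu>" using less by simp
  have e01: "es ! 0 \<le> es ! 1" using srt n2 len by (intro sorted_nth_mono) auto
  have zero: "es ! 0 = 0" "es ! 1 = 0"
    using eigenvalue_cases[OF ev, of "es ! 0"] eigenvalue_cases[OF ev, of "es ! 1"] e1 e01 n2 len by auto
  obtain B P Q where "schur_decomposition Z es = (B, P, Q)" by (metis prod_cases3)
  from schur_decomposition[OF cZ cp this]
  have sim: "similar_mat_wit Z B P Q" and ut: "upper_triangular B" and dB: "diag_mat B = es" by auto
  note D = similar_mat_witD2[OF cZ sim]
  have dB': "B $$ (i, i) = es ! i" if "i < n" for i
    using that dB D(5) by (auto simp: diag_mat_def)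
  let ?e = "unit_vec n :: nat \<Rightarrow> real vec"
  define c0 where "c0 = P *\<^sub>v ?e 0"
  define c1 where "c1 = P *\<^sub>v ?e 1"
  have c: "c0 \<in> carrier_vec n" "c1 \<in> carrier_vec n" using D by (auto simp: c0_def c1_def)
  have Be: "(B *\<^sub>v ?e k) $ i = B $$ (i, k)" if "i < n" "k < n" for i k
    using that D(5) by simp
  have ZP: "Z *\<^sub>v (P *\<^sub>v x) = P *\<^sub>v (B *\<^sub>v x)" if x: "x \<in> carrier_vec n" for x
  proof -
    have "Z *\<^sub>v (P *\<^sub>v x) = P *\<^sub>v (B *\<^sub>v (Q *\<^sub>v (P *\<^sub>v x)))"
      unfolding D(3) using D(5-7) x by (simp add: assoc_mult_mat_vec[of _ n n _ n] del: assoc_mult_mat)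
    also have "Q *\<^sub>v (P *\<^sub>v x) = x"
      using D(2,6,7) x
      by (simp flip: assoc_mult_mat_vec[of Q n n P n])
    finally show ?thesis .
  qed
  have "B *\<^sub>v ?e 0 = 0\<^sub>v n"
  proof (rule eq_vecI)
    fix i assume "i < dim_vec (0\<^sub>v n :: real vec)"
    then have i: "i < n" by simp
    have "B $$ (i, 0) = 0"
      using ut i D(5) dB'[of 0] zero by (cases "i = 0") (auto simp: upper_triangular_def)
    then show "(B *\<^sub>v ?e 0) $ i = 0\<^sub>v n $ i" using Be[of i 0] i by simp
  qed (use D(5) in auto)
  then have Zc0: "Z *\<^sub>v c0 = 0\<^sub>v n" using ZP[of "?e 0"] D(6) by (auto simp: c0_def)
  have "B *\<^sub>v ?e 1 = B $$ (0, 1) \<cdot>\<^sub>v ?e 0"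
  proof (rule eq_vecI)
    fix i assume "i < dim_vec (B $$ (0, 1) \<cdot>\<^sub>v ?e 0)"
    then have i: "i < n" by simp
    have "B $$ (i, 1) = 0" if "i \<noteq> 0"
      using that ut i D(5) dB'[of 1] zero by (cases "i = 1") (auto simp: upper_triangular_def)
    then show "(B *\<^sub>v ?e 1) $ i = (B $$ (0, 1) \<cdot>\<^sub>v ?e 0) $ i"
      using Be[of i 1] i n2 by (cases "i = 0") auto
  qed (use D(5) in auto)
  then have Zc1: "Z *\<^sub>v c1 = B $$ (0, 1) \<cdot>\<^sub>v c0"
    using ZP[of "?e 1"] D(6) by (simp add: c0_def c1_def mult_mat_vec[of _ n n])
  have Zc: "Z *\<^sub>v c1 \<in> carrier_vec n" using cZ c by simp
  have "(Z *\<^sub>v c1) \<bullet> (Z *\<^sub>v c1) = c1 \<bullet> (Z *\<^sub>v (Z *\<^sub>v c1))"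
    using sym_mats_adjoint[OF Z c(2) Zc] .
  also have "Z *\<^sub>v (Z *\<^sub>v c1) = 0\<^sub>v n"
    unfolding Zc1 using cZ c by (auto simp: mult_mat_vec[of _ n n] Zc0)
  finally have "Z *\<^sub>v c1 = 0\<^sub>v n" using scalar_prod_self_eq_0[OF Zc] c by simp
  from kernel[OF c(1) Zc0] kernel[OF c(2) this] obtain a b where
    ab: "c0 = a \<cdot>\<^sub>v z" "c1 = b \<cdot>\<^sub>v z" by blast
  have Qc: "Q *\<^sub>v c0 = ?e 0" "Q *\<^sub>v c1 = ?e 1"
    unfolding c0_def c1_def using D(2,6,7)
    by (simp_all flip: assoc_mult_mat_vec[of Q n n P n])
  define s where "s = Q *\<^sub>v z"
  have s: "s \<in> carrier_vec n" using D(7) z by (simp add: s_def)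
  have "a \<cdot>\<^sub>v s = ?e 0" "b \<cdot>\<^sub>v s = ?e 1"
    using Qc ab D(7) z by (simp_all add: s_def mult_mat_vec[of _ n n])
  then have "a * s $ 0 = 1" "b * s $ 0 = 0" "b * s $ 1 = 1"
    using n2 s index_smult_vec(1)[of 0 s a] index_smult_vec(1)[of 0 s b] index_smult_vec(1)[of 1 s b]
    by simp_all
  then show False by auto
qed

lemma rank_self_outer_add_rank: "vec_space.rank n (self_outer z) + vec_space.rank n Z = n"
proof -
  interpret vec_space "TYPE(real)" n .
  let ?O = "self_outer z"
  have cO: "?O \<in> carrier_mat n n" using z by (rule self_outer_carrier)
  have z0: "z \<noteq> 0\<^sub>v n" using z_norm n2 by auto
  have "det Z = 0" unfolding det_0_iff_vec_prod_zero[OF cZ] using z z0 Zz by blast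
  then have "rank Z \<noteq> n" using det_rank_iff[OF cZ] by blast
  then have rZ: "rank Z \<le> n - 1" using rank_le_nc[OF cZ] by linarith
  have rO: "rank ?O \<le> 1"
    using rank_le_1_product_entries[OF cO, of "($) z" "($) z"] z by (auto simp: self_outer_def)
  \<comment> \<open>\<open>z z\<^sup>T + Z\<close> is positive definite, so rank subadditivity gives the lower bound.\<close>
  have "det (?O + Z) \<noteq> 0"
  proof
    assume "det (?O + Z) = 0"
    then obtain v where v: "v \<in> carrier_vec n" "v \<noteq> 0\<^sub>v n" "(?O + Z) *\<^sub>v v = 0\<^sub>v n"
      using det_0_iff_vec_prod_zero[of "?O + Z" n] cO cZ by auto
    have "0 = v \<bullet> (?O *\<^sub>v v + Z *\<^sub>v v)"
      using v cO cZ by (simp add: add_mult_distrib_mat_vec[of _ n n])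
    also have "\<dots> = v \<bullet> (?O *\<^sub>v v) + v \<bullet> (Z *\<^sub>v v)"
      using v cO cZ by (simp add: scalar_prod_add_distrib[of _ n])
    also have "v \<bullet> (?O *\<^sub>v v) = (z \<bullet> v)\<^sup>2" using z v(1) by (rule self_outer_form)
    finally have eq: "0 = (z \<bullet> v)\<^sup>2 + v \<bullet> (Z *\<^sub>v v)" .
    have "v \<bullet> (Z *\<^sub>v v) \<ge> 0" using psd v by (simp add: psd_mat_def)
    then have "(z \<bullet> v)\<^sup>2 = 0" "v \<bullet> (Z *\<^sub>v v) = 0" using eq zero_le_power2[of "z \<bullet> v"] by linarith+
    then have "\<mu> * (v \<bullet> v) \<le> 0" using form[OF v(1)] by simp
    then have "v \<bullet> v = 0" using \<mu> scalar_prod_self_nonneg[of v] by (simp add: mult_le_0_iff)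
    then show False using scalar_prod_self_eq_0[OF v(1)] v by simp
  qed
  then have "rank (?O + Z) = n" using det_rank_iff[of "?O + Z"] cO cZ by auto
  then have "n \<le> rank ?O + rank Z" using rank_subadditive[OF cO cZ] by simp
  then show ?thesis using rZ rO n2 by linarith
qed

end

section \<open>The trace inner product of positive semidefinite matrices\<close>

text \<open>The trace inner product of two positive semidefinite matrices is nonnegative. The proof
  is by elimination of the last variable of \<open>X\<close>: if \<open>x\<close> is the last column and \<open>d\<close> the last
  diagonal entry of \<open>X\<close>, then \<open>X = x x\<^sup>T / d + Y\<close> where the Schur complement \<open>Y\<close> is again
  positive semidefinite and vanishes in the last row and column. If \<open>d = 0\<close>, then \<open>x = 0\<close> and
  the last row and column of \<open>X\<close> vanish already.\<close>

lemma sum_psd_mult_nonneg: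
  fixes P X :: "nat \<Rightarrow> nat \<Rightarrow> real"
  assumes "\<And>x. 0 \<le> (\<Sum>i<n. \<Sum>j<n. x i * P i j * x j)"
    and "\<And>x. 0 \<le> (\<Sum>i<n. \<Sum>j<n. x i * X i j * x j)"
    and "\<And>i j. i < n \<Longrightarrow> j < n \<Longrightarrow> X i j = X j i"
  shows "0 \<le> (\<Sum>i<n. \<Sum>j<n. P i j * X i j)"
  using assms
proof (induction n arbitrary: X)
  case (Suc n)
  note P = Suc.prems(1) and X = Suc.prems(2) and sym = Suc.prems(3)
  have split: "(\<Sum>i<Suc n. \<Sum>j<Suc n. f i j) = (\<Sum>i<n. \<Sum>j<n. f i j) + (\<Sum>i<n. f i n) + (\<Sum>j<n. f n j) + f n n"
    for f :: "nat \<Rightarrow> nat \<Rightarrow> real"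
    by (simp add: sum.distrib)
  define d where "d = X n n"
  define s where "s x = (\<Sum>i<n. x i * X i n)" for x :: "nat \<Rightarrow> real"
  have expand: "(\<Sum>i<Suc n. \<Sum>j<Suc n. x i * X i j * x j)
     = (\<Sum>i<n. \<Sum>j<n. x i * X i j * x j) + 2 * x n * s x + d * (x n)\<^sup>2" for x
  proof -
    have "(\<Sum>j<n. x n * X n j * x j) = x n * s x" "(\<Sum>i<n. x i * X i n * x n) = x n * s x"
      using sym by (auto simp: s_def sum_distrib_left mult_ac intro!: sum.cong)
    then show ?thesis unfolding split by (simp add: d_def power2_eq_square)
  qed
  have P': "0 \<le> (\<Sum>i<n. \<Sum>j<n. x i * P i j * x j)" for x
    using P[of "x(n := 0)"] by (simp add: split)
  have nonneg: "0 \<le> (\<Sum>i<n. \<Sum>j<n. x i * X i j * x j) + 2 * t * s x + d * t\<^sup>2" for x t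
  proof -
    have "s (x(n := t)) = s x" by (simp add: s_def)
    then show ?thesis using X[of "x(n := t)"] expand[of "x(n := t)"] by simp
  qed
  have d0: "0 \<le> d" using nonneg[of "\<lambda>_. 0" 1] by (simp add: s_def)
  \<comment> \<open>If \<open>d = 0\<close>, then \<open>Y = X\<close> by the convention \<open>a / 0 = 0\<close>.\<close>
  define Y where "Y i j = X i j - X i n * X j n / d" for i j
  have s2: "(s x)\<^sup>2 = (\<Sum>i<n. \<Sum>j<n. x i * (X i n * X j n) * x j)" for x
    by (simp add: s_def power2_eq_square sum_product mult_ac)
  have Yx: "(\<Sum>i<n. \<Sum>j<n. x i * Y i j * x j) = (\<Sum>i<n. \<Sum>j<n. x i * X i j * x j) - (s x)\<^sup>2 / d" for x
    unfolding s2 Y_def by (simp add: algebra_simps sum_subtractf sum_divide_distrib)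
  have zero: "X i n = 0" if "d = 0" "i < n" for i
  proof (rule ccontr)
    assume ne: "X i n \<noteq> 0"
    define e :: "nat \<Rightarrow> real" where "e = (\<lambda>j. of_bool (j = i))"
    have "s e = X i n" using that by (simp add: s_def e_def)
    moreover define q where "q = (\<Sum>i<n. \<Sum>j<n. e i * X i j * e j)"
    ultimately have "0 \<le> q + 2 * (- (1 + q) / (2 * X i n)) * X i n"
      using nonneg[of e "- (1 + q) / (2 * X i n)"] that by simp
    also have "\<dots> = - 1" using ne by (simp add: field_simps)
    finally show False by simp
  qed
  have Y: "0 \<le> (\<Sum>i<n. \<Sum>j<n. x i * Y i j * x j)" for x
  proof (cases "d = 0")
    case True
    then show ?thesis using nonneg[of x 0] unfolding Yx by simp
  next
    case False
    have "2 * (- s x / d) * s x + d * (- s x / d)\<^sup>2 = - (s x)\<^sup>2 / d"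
      using False by (simp add: field_simps power2_eq_square)
    then show ?thesis using nonneg[of x "- s x / d"] unfolding Yx by simp
  qed
  have "0 \<le> (\<Sum>i<n. \<Sum>j<n. P i j * Y i j)"
    using sym by (intro Suc.IH P' Y) (auto simp: Y_def mult_ac)
  also have "\<dots> \<le> (\<Sum>i<Suc n. \<Sum>j<Suc n. P i j * X i j)"
  proof (cases "d = 0")
    case True
    have "X n i = 0" if "i < n" for i using zero[OF True that] sym[of n i] that by simp
    then show ?thesis using True zero unfolding split by (simp add: Y_def d_def)
  next
    case False
    have ex: "P i j * X i j = P i j * (if i < n \<and> j < n then Y i j else 0) + X i n * P i j * X j n / d"
      if "i < Suc n" "j < Suc n" for i j
    proof -
      have eq: "X i n * X j n / d = X i j" if "\<not> (i < n \<and> j < n)"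
        using that \<open>i < Suc n\<close> \<open>j < Suc n\<close> False sym[of n j]
        by (cases "i = n"; cases "j = n") (simp_all add: d_def)
      show ?thesis
      proof (cases "i < n \<and> j < n")
        case False
        then show ?thesis unfolding eq[OF False, symmetric] using False by (auto simp: mult_ac)
      qed (simp add: Y_def algebra_simps)
    qed
    have "(\<Sum>i<Suc n. \<Sum>j<Suc n. P i j * X i j)
       = (\<Sum>i<Suc n. \<Sum>j<Suc n. P i j * (if i < n \<and> j < n then Y i j else 0) + X i n * P i j * X j n / d)"
      using ex by (intro sum.cong refl) auto
    also have "\<dots> = (\<Sum>i<n. \<Sum>j<n. P i j * Y i j) + (\<Sum>i<Suc n. \<Sum>j<Suc n. X i n * P i j * X j n) / d"
      by (simp only: sum.distrib sum_divide_distrib[symmetric]) (simp add: split)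
    also have "\<dots> \<ge> (\<Sum>i<n. \<Sum>j<n. P i j * Y i j)"
      using P[of "\<lambda>i. X i n"] d0 by simp
    finally show ?thesis by simp
  qed
  finally show ?case .
qed simp

lemma trace_inner_sum:
  assumes "A \<in> carrier_mat n n" "X \<in> carrier_mat n n"
  shows "trace_inner A X = (\<Sum>i<n. \<Sum>j<n. A $$ (i, j) * X $$ (i, j))"
proof -
  have "trace_inner A X = (\<Sum>j<n. \<Sum>i<n. A $$ (i, j) * X $$ (i, j))"
    using assms unfolding trace_inner_def mat_trace_def
    by (auto simp: scalar_prod_def atLeast0LessThan intro!: sum.cong)
  then show ?thesis by (subst sum.swap)
qed

lemma psd_mat_sum_nonneg:
  assumes "psd_mat n X"
  shows "0 \<le> (\<Sum>i<n. \<Sum>j<n. x i * X $$ (i, j) * x j)"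
proof -
  have cX: "X \<in> carrier_mat n n" using assms by (auto simp: psd_mat_def sym_mats_def)
  have "(\<Sum>i<n. \<Sum>j<n. x i * X $$ (i, j) * x j) = vec n x \<bullet> (X *\<^sub>v vec n x)"
    by (subst bilinear_sum[OF cX]) auto
  then show ?thesis using assms by (simp add: psd_mat_def)
qed

lemma psd_trace_nonneg:
  assumes "psd_mat n P" "psd_mat n X"
  shows "0 \<le> trace_inner P X"
proof -
  have c: "P \<in> carrier_mat n n" "X \<in> carrier_mat n n" and s: "X \<in> sym_mats n"
    using assms by (auto simp: psd_mat_def sym_mats_def)
  show ?thesis unfolding trace_inner_sum[OF c]
    by (rule sum_psd_mult_nonneg[OF psd_mat_sum_nonneg[OF assms(1)] psd_mat_sum_nonneg[OF assms(2)]
        sym_mats_index[OF s]])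
qed

lemma psd_mat_kernel:
  assumes S: "psd_mat n S" and v: "v \<in> carrier_vec n" and q: "v \<bullet> (S *\<^sub>v v) = 0"
  shows "S *\<^sub>v v = 0\<^sub>v n"
proof -
  have sS: "S \<in> sym_mats n" and cS: "S \<in> carrier_mat n n"
    using S by (auto simp: psd_mat_def sym_mats_def)
  define w where "w = S *\<^sub>v v"
  have w: "w \<in> carrier_vec n" using cS v by (simp add: w_def)
  define b where "b = w \<bullet> (S *\<^sub>v w)"
  have b: "b \<ge> 0" using S w by (simp add: b_def psd_mat_def)
  \<comment> \<open>A step from \<open>v\<close> along \<open>- S v\<close>, short enough to make the form negative unless \<open>S v = 0\<close>.\<close>
  define t where "t = - (w \<bullet> w) / (b + 1)"
  have "0 \<le> (v + t \<cdot>\<^sub>v w) \<bullet> (S *\<^sub>v (v + t \<cdot>\<^sub>v w))" using S v w by (simp add: psd_mat_def)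
  also have "S *\<^sub>v (v + t \<cdot>\<^sub>v w) = w + t \<cdot>\<^sub>v (S *\<^sub>v w)"
    using cS v w
    by (simp add: mult_add_distrib_mat_vec[of _ n n] mult_mat_vec[of _ n n] w_def[symmetric])
  also have "(v + t \<cdot>\<^sub>v w) \<bullet> (w + t \<cdot>\<^sub>v (S *\<^sub>v w))
      = v \<bullet> w + t * (v \<bullet> (S *\<^sub>v w)) + t * (w \<bullet> w) + t * t * b"
    using cS v w
    by (simp add: scalar_prod_add_distrib[of _ n] add_scalar_prod_distrib[of _ n] b_def algebra_simps)
  also have "v \<bullet> (S *\<^sub>v w) = w \<bullet> w" using sym_mats_adjoint[OF sS v w] by (simp add: w_def)
  also have "v \<bullet> w = 0" using q by (simp add: w_def)
  finally have "0 \<le> 2 * t * (w \<bullet> w) + t * t * b" by simp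
  then have "0 \<le> (2 * t * (w \<bullet> w) + t * t * b) * (b + 1)\<^sup>2" by simp
  also have "\<dots> = 2 * (t * (b + 1)) * (w \<bullet> w) * (b + 1) + (t * (b + 1))\<^sup>2 * b"
    by (simp add: power2_eq_square algebra_simps)
  also have "t * (b + 1) = - (w \<bullet> w)" using b by (simp add: t_def)
  finally have "(w \<bullet> w)\<^sup>2 * (b + 2) \<le> 0"
    by (simp add: power2_eq_square algebra_simps)
  then have "w \<bullet> w = 0" using b by (simp add: mult_le_0_iff)
  then show ?thesis using scalar_prod_self_eq_0[OF w] by (simp add: w_def)
qed

section \<open>The dual certificate of a sign vector\<close>

text \<open>The only vector \<open>y\<close> for which the slack matrix \<open>- M - Diag y\<close> annihilates the sign
  vector \<open>z\<close>.\<close>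

definition dual_candidate :: "nat \<Rightarrow> real mat \<Rightarrow> real vec \<Rightarrow> real vec" where
  "dual_candidate n M z = vec n (\<lambda>i. - z $ i * (M *\<^sub>v z) $ i)"

text \<open>The slack matrix of this dual vector.\<close>

definition candidate_slack :: "nat \<Rightarrow> real mat \<Rightarrow> real vec \<Rightarrow> real mat" where
  "candidate_slack n M z = - M - diag_of_vec (dual_candidate n M z)"

lemma diag_of_vec_carrier: "y \<in> carrier_vec n \<Longrightarrow> diag_of_vec y \<in> carrier_mat n n"
  by (auto simp: diag_of_vec_def mat_diag_def)

lemma diag_of_vec_mult:
  assumes "y \<in> carrier_vec n" "v \<in> carrier_vec n"
  shows "diag_of_vec y *\<^sub>v v = vec n (\<lambda>i. y $ i * v $ i)"
proof (rule eq_vecI)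
  fix i assume "i < dim_vec (vec n (\<lambda>i. y $ i * v $ i))"
  then have i: "i < n" by simp
  have "(diag_of_vec y *\<^sub>v v) $ i = (\<Sum>j<n. diag_of_vec y $$ (i, j) * v $ j)"
    by (rule mult_mat_vec_sum[OF diag_of_vec_carrier[OF assms(1)] assms(2) i])
  also have "\<dots> = (\<Sum>j<n. if j = i then y $ i * v $ i else 0)"
    using assms i by (intro sum.cong) (auto simp: diag_of_vec_def mat_diag_def)
  finally show "(diag_of_vec y *\<^sub>v v) $ i = vec n (\<lambda>i. y $ i * v $ i) $ i" using i by simp
qed (use assms diag_of_vec_carrier in auto)

text \<open>The certificate: the slack matrix is at least \<open>\<mu> > 0\<close> on the orthogonal complement of
  \<open>z\<close>. The lemmas of this locale derive from it that the semidefinite program is simple with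
  primal solution \<open>z z\<^sup>T\<close> and dual solution \<open>y\<close>.\<close>

locale certified_labels =
  fixes n :: nat and M :: "real mat" and z :: "real vec" and \<mu> :: real
  assumes M: "M \<in> sym_mats n" and z: "z \<in> carrier_vec n" and z_sign: "\<And>i. i < n \<Longrightarrow> z $ i \<in> {-1, 1}"
    and \<mu>: "\<mu> > 0" and n2: "n \<ge> 2"
    and form: "\<And>v. v \<in> carrier_vec n \<Longrightarrow> z \<bullet> v = 0 \<Longrightarrow>
        v \<bullet> (candidate_slack n M z *\<^sub>v v) \<ge> \<mu> * (v \<bullet> v)"
begin

abbreviation "y \<equiv> dual_candidate n M z"
abbreviation "Z \<equiv> candidate_slack n M z"
abbreviation "P \<equiv> max_diag_sdp n M"
abbreviation "X0 \<equiv> self_outer z"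

lemma cM: "M \<in> carrier_mat n n" using M by (rule sym_mats_carrier)

lemma y: "y \<in> carrier_vec n" by (simp add: dual_candidate_def)

lemma zz: "i < n \<Longrightarrow> z $ i * z $ i = 1" using z_sign[of i] by auto

lemma z_norm: "z \<bullet> z = real n"
  using z by (simp add: scalar_prod_sum[of _ n] zz)

lemma slack_mult:
  assumes y': "y' \<in> carrier_vec n" and v: "v \<in> carrier_vec n"
  shows "(- M - diag_of_vec y') *\<^sub>v v = vec n (\<lambda>i. - (M *\<^sub>v v) $ i - y' $ i * v $ i)"
proof -
  have "(- M - diag_of_vec y') *\<^sub>v v = - M *\<^sub>v v - diag_of_vec y' *\<^sub>v v"
    using cM v diag_of_vec_carrier[OF y'] by (intro minus_mult_distrib_mat_vec[of _ n n]) auto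
  then show ?thesis using cM v y' by (auto simp: diag_of_vec_mult)
qed

lemma slack_z: "Z *\<^sub>v z = 0\<^sub>v n"
  unfolding candidate_slack_def slack_mult[OF y z]
proof (rule eq_vecI, goal_cases)
  case (1 i)
  then have i: "i < n" by simp
  have "z $ i * (M *\<^sub>v z) $ i * z $ i = (z $ i * z $ i) * (M *\<^sub>v z) $ i"
    by (simp only: mult_ac)
  also have "\<dots> = (M *\<^sub>v z) $ i" using zz[OF i] by (simp del: index_mult_mat_vec)
  finally have "z $ i * (M *\<^sub>v z) $ i * z $ i = (M *\<^sub>v z) $ i" .
  then show ?case using i by (simp add: dual_candidate_def del: index_mult_mat_vec)
qed simp

lemma slack_sym: "y' \<in> carrier_vec n \<Longrightarrow> - M - diag_of_vec y' \<in> sym_mats n"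
  using cM diag_of_vec_carrier[of y' n] sym_mats_index[OF M]
  by (intro sym_matsI) (auto simp: diag_of_vec_def mat_diag_def)

sublocale gapped_matrix n Z z \<mu>
  by unfold_locales (use slack_sym[OF y] z slack_z z_norm \<mu> n2 form in \<open>auto simp: candidate_slack_def\<close>)

lemma primal_feasible_iff:
  "primal_feasible P X \<longleftrightarrow> psd_mat n X \<and> (\<forall>i<n. X $$ (i, i) = 1)"
proof (cases "psd_mat n X")
  case True
  then have "X \<in> carrier_mat n n" by (auto simp: psd_mat_def sym_mats_def)
  then have "constr_map P X = sdp_rhs P \<longleftrightarrow> (\<forall>i<n. X $$ (i, i) = 1)"
    by (subst constr_map_max_diag_sdp) (auto simp: max_diag_sdp_def vec_eq_iff)
  then show ?thesis using True by (simp add: primal_feasible_def max_diag_sdp_def)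
qed (simp add: primal_feasible_def max_diag_sdp_def)

lemma dual_feasible_iff:
  "dual_feasible P y' \<longleftrightarrow> y' \<in> carrier_vec n \<and> psd_mat n (- M - diag_of_vec y')"
proof (cases "y' \<in> carrier_vec n")
  case True
  then show ?thesis using slack_max_diag_sdp[OF True, of M]
    by (simp add: dual_feasible_def max_diag_sdp_def)
qed (simp add: dual_feasible_def max_diag_sdp_def)

lemma cX0: "X0 \<in> carrier_mat n n" using z by (rule self_outer_carrier)

lemma X0_psd: "psd_mat n X0"
  unfolding psd_mat_def
proof (intro conjI ballI)
  show "X0 \<in> sym_mats n" using z by (intro sym_matsI) (auto simp: self_outer_def)
  show "0 \<le> v \<bullet> (X0 *\<^sub>v v)" if "v \<in> carrier_vec n" for v
    using self_outer_form[OF z that] by simp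
qed

lemma X0_feasible: "primal_feasible P X0"
  unfolding primal_feasible_iff using X0_psd zz z by (auto simp: self_outer_def)

lemma cost_eq:
  assumes "primal_feasible P X"
  shows "trace_inner (sdp_cost P) X = trace_inner Z X + (\<Sum>i<n. y $ i)"
proof -
  have X: "psd_mat n X" "\<And>i. i < n \<Longrightarrow> X $$ (i, i) = 1" using assms primal_feasible_iff by auto
  then have cX: "X \<in> carrier_mat n n" by (auto simp: psd_mat_def sym_mats_def)
  have "trace_inner (- M) X - trace_inner Z X = (\<Sum>i<n. \<Sum>j<n. if j = i then y $ i else 0)"
    unfolding trace_inner_sum[OF uminus_carrier_mat[OF cM] cX] trace_inner_sum[OF cZ cX]
      sum_subtractf[symmetric]
    using cM y X(2)
    by (intro sum.cong refl)
      (auto simp: candidate_slack_def diag_of_vec_def mat_diag_def algebra_simps)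
  then show ?thesis by (simp add: max_diag_sdp_def)
qed

lemma trace_slack_X0: "trace_inner Z X0 = 0"
proof -
  have "trace_inner Z X0 = z \<bullet> (Z *\<^sub>v z)"
    unfolding trace_inner_sum[OF cZ cX0] bilinear_sum[OF cZ z] using z
    by (intro sum.cong refl) (auto simp: self_outer_def)
  then show ?thesis using slack_z z by simp
qed

lemma X0_solution: "primal_solution P X0"
  unfolding primal_solution_def
proof (intro conjI allI impI X0_feasible)
  fix X assume X: "primal_feasible P X"
  then have "0 \<le> trace_inner Z X" using psd_trace_nonneg[OF psd] primal_feasible_iff by blast
  then show "trace_inner (sdp_cost P) X0 \<le> trace_inner (sdp_cost P) X"
    using cost_eq[OF X] cost_eq[OF X0_feasible] trace_slack_X0 by simp
qed

text \<open>An optimal \<open>X\<close> has \<open>tr (Z X) = 0\<close>. Since \<open>Z - \<mu> (I - z z\<^sup>T / n)\<close> is positive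
  semidefinite, this forces \<open>z \<bullet> (X z) \<ge> n\<^sup>2\<close>. This form is the sum of the \<open>n\<^sup>2\<close> numbers
  \<open>z $ i * z $ j * X $$ (i, j)\<close>, each of which is at most \<open>1\<close> because the diagonal of \<open>X\<close> is
  \<open>1\<close>; so all of them are \<open>1\<close>.\<close>

lemma primal_solution_unique:
  assumes "primal_solution P X"
  shows "X = X0"
proof -
  have f: "primal_feasible P X" using assms by (simp add: primal_solution_def)
  then have X: "psd_mat n X" and X1: "\<And>i. i < n \<Longrightarrow> X $$ (i, i) = 1" using primal_feasible_iff by auto
  then have sX: "X \<in> sym_mats n" and cX: "X \<in> carrier_mat n n" by (auto simp: psd_mat_def sym_mats_def)
  have "trace_inner (sdp_cost P) X \<le> trace_inner (sdp_cost P) X0"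
    using assms X0_feasible by (simp add: primal_solution_def)
  then have tr: "trace_inner Z X \<le> 0"
    using cost_eq[OF f] cost_eq[OF X0_feasible] trace_slack_X0 by simp
  \<comment> \<open>\<open>a\<close> has the entries of \<open>Z - \<mu> (I - z z\<^sup>T / n)\<close>.\<close>
  define a where "a i j = Z $$ (i, j) - \<mu> * (of_bool (i = j) - z $ i * z $ j / n)" for i j
  have "0 \<le> (\<Sum>i<n. \<Sum>j<n. x i * a i j * x j)" for x
  proof -
    define v where "v = vec n x"
    have v: "v \<in> carrier_vec n" by (simp add: v_def)
    have "(\<Sum>i<n. \<Sum>j<n. x i * a i j * x j)
      = (\<Sum>i<n. \<Sum>j<n. x i * Z $$ (i, j) * x j) - \<mu> * ((\<Sum>i<n. \<Sum>j<n. if j = i then x i * x i else 0)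
          - (\<Sum>i<n. \<Sum>j<n. (z $ i * x i) * (z $ j * x j)) / n)"
      unfolding sum_distrib_left sum_divide_distrib sum_subtractf[symmetric]
      by (intro sum.cong refl) (auto simp: a_def algebra_simps)
    also have "\<dots> = v \<bullet> (Z *\<^sub>v v) - \<mu> * (v \<bullet> v - (z \<bullet> v)\<^sup>2 / n)"
      unfolding bilinear_sum[OF cZ v] scalar_prod_sum[OF v] power2_eq_square sum_product
      by (simp add: v_def)
    finally show ?thesis using form_general(1)[OF v] by simp
  qed
  then have "0 \<le> (\<Sum>i<n. \<Sum>j<n. a i j * X $$ (i, j))"
    by (rule sum_psd_mult_nonneg[OF _ psd_mat_sum_nonneg[OF X] sym_mats_index[OF sX]])
  also have "\<dots> = trace_inner Z X - \<mu> * ((\<Sum>i<n. \<Sum>j<n. if j = i then 1 else 0)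
      - (\<Sum>i<n. \<Sum>j<n. z $ i * z $ j * X $$ (i, j)) / n)"
    unfolding trace_inner_sum[OF cZ cX] sum_distrib_left sum_divide_distrib sum_subtractf[symmetric]
    by (intro sum.cong refl) (auto simp: a_def algebra_simps X1)
  finally have "\<mu> * (real n - (\<Sum>i<n. \<Sum>j<n. z $ i * z $ j * X $$ (i, j)) / n) \<le> 0"
    using tr by simp
  then have "real n \<le> (\<Sum>i<n. \<Sum>j<n. z $ i * z $ j * X $$ (i, j)) / n"
    using \<mu> by (simp add: mult_le_0_iff)
  then have big: "(\<Sum>i<n. \<Sum>j<n. 1 - z $ i * z $ j * X $$ (i, j)) \<le> 0"
    using n2 by (simp add: sum_subtractf field_simps)
  have entry: "0 \<le> 1 - z $ i * z $ j * X $$ (i, j)" if ij: "i < n" "j < n" for i j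
  proof (cases "i = j")
    case True
    then show ?thesis using X1 zz ij by simp
  next
    case False
    \<comment> \<open>The form of \<open>X\<close> at \<open>z $ i * e\<^sub>i - z $ j * e\<^sub>j\<close> is twice the right-hand side.\<close>
    define x where "x k = (if k = i then z $ i else if k = j then - z $ j else 0)" for k
    have "(\<Sum>k<n. \<Sum>l<n. x k * X $$ (k, l) * x l) = (\<Sum>k\<in>{i, j}. \<Sum>l\<in>{i, j}. x k * X $$ (k, l) * x l)"
    proof -
      have "(\<Sum>l<n. x k * X $$ (k, l) * x l) = (\<Sum>l\<in>{i, j}. x k * X $$ (k, l) * x l)" for k
        using ij by (intro sum.mono_neutral_right) (auto simp: x_def)
      then show ?thesis
        using ij by (simp only:) (intro sum.mono_neutral_right, auto simp: x_def)
    qed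
    also have "\<dots> = z $ i * z $ i + z $ j * z $ j - 2 * (z $ i * z $ j * X $$ (i, j))"
      using False X1 ij sym_mats_index[OF sX, of j i] by (simp add: x_def algebra_simps)
    also have "\<dots> = 2 - 2 * (z $ i * z $ j * X $$ (i, j))" using zz ij by simp
    finally show ?thesis using psd_mat_sum_nonneg[OF X, of x] by simp
  qed
  have one: "z $ i * z $ j * X $$ (i, j) = 1" if ij: "i < n" "j < n" for i j
  proof -
    have "(\<Sum>i<n. \<Sum>j<n. 1 - z $ i * z $ j * X $$ (i, j)) = 0"
      using big entry by (intro antisym sum_nonneg) auto
    then have "\<forall>i<n. (\<Sum>j<n. 1 - z $ i * z $ j * X $$ (i, j)) = 0"
      using entry by (subst (asm) sum_nonneg_eq_0_iff) (auto intro!: sum_nonneg)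
    then have "(\<Sum>j<n. 1 - z $ i * z $ j * X $$ (i, j)) = 0" using ij by blast
    then have "\<forall>j<n. 1 - z $ i * z $ j * X $$ (i, j) = 0"
      using entry ij by (subst (asm) sum_nonneg_eq_0_iff) auto
    then show ?thesis using ij by simp
  qed
  show "X = X0"
  proof (rule eq_matI)
    fix i j assume "i < dim_row X0" "j < dim_col X0"
    then have ij: "i < n" "j < n" using z by (auto simp: self_outer_def)
    show "X $$ (i, j) = X0 $$ (i, j)"
      using one[OF ij] z_sign[OF ij(1)] z_sign[OF ij(2)] ij z by (auto simp: self_outer_def)
  qed (use cX z in \<open>auto simp: self_outer_def\<close>)
qed

text \<open>Evaluating the slack form at \<open>z\<close> replaces weak duality: the dual objective falls short
  of its upper bound by exactly this form.\<close>

lemma dual_gap: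
  assumes "y' \<in> carrier_vec n"
  shows "sdp_rhs P \<bullet> y' = - (z \<bullet> (M *\<^sub>v z)) - z \<bullet> ((- M - diag_of_vec y') *\<^sub>v z)"
proof -
  have "z \<bullet> ((- M - diag_of_vec y') *\<^sub>v z)
      = (\<Sum>i<n. - (z $ i * (M *\<^sub>v z) $ i) - (z $ i * z $ i) * y' $ i)"
    unfolding slack_mult[OF assms z]
    by (subst scalar_prod_sum[of _ n]) (auto simp: algebra_simps simp del: index_mult_mat_vec)
  also have "\<dots> = - (\<Sum>i<n. z $ i * (M *\<^sub>v z) $ i) - (\<Sum>i<n. y' $ i)"
    by (simp add: sum_subtractf sum_negf zz del: index_mult_mat_vec)
  also have "(\<Sum>i<n. z $ i * (M *\<^sub>v z) $ i) = z \<bullet> (M *\<^sub>v z)"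
    using cM z by (subst scalar_prod_sum[of _ n]) auto
  also have "(\<Sum>i<n. y' $ i) = sdp_rhs P \<bullet> y'"
    using assms by (simp add: scalar_prod_sum[of _ n] max_diag_sdp_def)
  finally show ?thesis by simp
qed

lemma dual_value: "sdp_rhs P \<bullet> y = - (z \<bullet> (M *\<^sub>v z))"
  using dual_gap[OF y] slack_z z by (simp add: candidate_slack_def)

lemma y_solution: "dual_solution P y"
  unfolding dual_solution_def
proof (intro conjI allI impI)
  show "dual_feasible P y" using dual_feasible_iff y psd by (simp add: candidate_slack_def)
  fix y' assume y': "dual_feasible P y'"
  then have "0 \<le> z \<bullet> ((- M - diag_of_vec y') *\<^sub>v z)" using dual_feasible_iff z by (simp add: psd_mat_def)
  then show "sdp_rhs P \<bullet> y' \<le> sdp_rhs P \<bullet> y"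
    using dual_gap y' dual_feasible_iff dual_value by simp
qed

lemma dual_solution_unique:
  assumes "dual_solution P y'"
  shows "y' = y"
proof -
  have y': "y' \<in> carrier_vec n" and psd': "psd_mat n (- M - diag_of_vec y')"
    using assms dual_feasible_iff by (auto simp: dual_solution_def)
  have "sdp_rhs P \<bullet> y \<le> sdp_rhs P \<bullet> y'"
    using assms y_solution by (auto simp: dual_solution_def)
  then have "z \<bullet> ((- M - diag_of_vec y') *\<^sub>v z) \<le> 0"
    using dual_gap[OF y'] dual_value by simp
  moreover have "z \<bullet> ((- M - diag_of_vec y') *\<^sub>v z) \<ge> 0" using psd' z by (simp add: psd_mat_def)
  ultimately have "(- M - diag_of_vec y') *\<^sub>v z = 0\<^sub>v n"
    by (intro psd_mat_kernel[OF psd' z]) simp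
  then have v0: "vec n (\<lambda>i. - (M *\<^sub>v z) $ i - y' $ i * z $ i) = 0\<^sub>v n" unfolding slack_mult[OF y' z] .
  show ?thesis
  proof (rule eq_vecI)
    fix i assume "i < dim_vec y"
    then have i: "i < n" using y by simp
    have "y' $ i * z $ i = - (M *\<^sub>v z) $ i"
      using arg_cong[OF v0, of "\<lambda>v. v $ i"] i by (simp del: index_mult_mat_vec)
    then have "y' $ i * (z $ i * z $ i) = - (M *\<^sub>v z) $ i * z $ i"
      by (simp only: mult.assoc[symmetric])
    then show "y' $ i = y $ i"
      using zz[OF i] i by (simp add: dual_candidate_def del: index_mult_mat_vec)
  qed (use y y' in auto)
qed

lemma slack_y: "slack P y = Z"
  using slack_max_diag_sdp[OF y] by (simp add: candidate_slack_def)

lemma strong_duality: "strong_duality P"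
  unfolding strong_duality_def
proof (intro conjI allI impI)
  show "\<exists>X y. primal_solution P X \<and> dual_solution P y" using X0_solution y_solution by blast
  fix X y' assume "primal_solution P X \<and> dual_solution P y'"
  then have eq: "X = X0" "y' = y" using primal_solution_unique dual_solution_unique by auto
  have "sdp_cost P = - M" by (simp add: max_diag_sdp_def)
  moreover have "- M = (- M)\<^sup>T" using M by (auto simp: sym_mats_def transpose_uminus)
  ultimately have "mat_trace (sdp_cost P * X0) = trace_inner (sdp_cost P) X0"
    by (simp add: trace_inner_def)
  also have "\<dots> = (\<Sum>i<n. y $ i)" using cost_eq[OF X0_feasible] trace_slack_X0 by simp
  also have "\<dots> = sdp_rhs P \<bullet> y"
    using y by (simp add: scalar_prod_sum[of _ n] max_diag_sdp_def)
  finally show "mat_trace (sdp_cost P * X) = sdp_rhs P \<bullet> y'" using eq by simp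
qed

lemma surjective: "surjective_constr_map P"
proof -
  have "v \<in> constr_map P ` sym_mats n" if v: "v \<in> carrier_vec n" for v
  proof
    have c: "diag_of_vec v \<in> carrier_mat n n" using v by (rule diag_of_vec_carrier)
    show "diag_of_vec v \<in> sym_mats n"
      using c v by (intro sym_matsI) (auto simp: diag_of_vec_def mat_diag_def)
    show "v = constr_map P (diag_of_vec v)"
      unfolding constr_map_max_diag_sdp[OF c] using v
      by (intro eq_vecI) (auto simp: diag_of_vec_def mat_diag_def)
  qed
  then show ?thesis
    unfolding surjective_constr_map_def
    by (auto simp: max_diag_sdp_def constr_map_def)
qed

lemma simple: "simple_sdp P"
  unfolding simple_sdp_def
proof (intro conjI strong_duality surjective)
  have "sdp_dim P = n" by (simp add: max_diag_sdp_def)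
  then show "strict_complementarity P"
    unfolding strict_complementarity_def
    using X0_solution y_solution rank_self_outer_add_rank slack_y
    by (intro exI[of _ X0] exI[of _ y]) simp
  show "\<exists>!X. primal_solution P X" using X0_solution primal_solution_unique by blast
  show "\<exists>!y. dual_solution P y" using y_solution dual_solution_unique by blast
qed

end

lemma candidate_slack_form:
  assumes M: "M \<in> carrier_mat n n" and z: "z \<in> carrier_vec n" and v: "v \<in> carrier_vec n"
  shows "v \<bullet> (candidate_slack n M z *\<^sub>v v)
    = (\<Sum>i<n. z $ i * (M *\<^sub>v z) $ i * (v $ i)\<^sup>2) - v \<bullet> (M *\<^sub>v v)"
proof -
  let ?y = "dual_candidate n M z"
  have y: "?y \<in> carrier_vec n" by (simp add: dual_candidate_def)
  have "candidate_slack n M z *\<^sub>v v = - M *\<^sub>v v - diag_of_vec ?y *\<^sub>v v"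
    unfolding candidate_slack_def
    using M v diag_of_vec_carrier[OF y] by (intro minus_mult_distrib_mat_vec[of _ n n]) auto
  then have "v \<bullet> (candidate_slack n M z *\<^sub>v v)
      = (\<Sum>i<n. v $ i * (- (M *\<^sub>v v) $ i + z $ i * (M *\<^sub>v z) $ i * v $ i))"
    using M v y by (subst scalar_prod_sum[of _ n])
      (auto simp: diag_of_vec_mult dual_candidate_def simp del: index_mult_mat_vec intro!: sum.cong)
  also have "\<dots> = (\<Sum>i<n. z $ i * (M *\<^sub>v z) $ i * (v $ i)\<^sup>2) - (\<Sum>i<n. v $ i * (M *\<^sub>v v) $ i)"
    unfolding sum_subtractf[symmetric]
    by (intro sum.cong refl) (simp add: power2_eq_square algebra_simps del: index_mult_mat_vec)
  also have "(\<Sum>i<n. v $ i * (M *\<^sub>v v) $ i) = v \<bullet> (M *\<^sub>v v)"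
    using M v by (subst scalar_prod_sum[of _ n]) auto
  finally show ?thesis .
qed

lemma certified_labels_smult:
  assumes "certified_labels n M z \<mu>" "s > 0"
  shows "certified_labels n (s \<cdot>\<^sub>m M) z (s * \<mu>)"
proof -
  interpret certified_labels n M z \<mu> by fact
  show ?thesis
  proof
    show "s \<cdot>\<^sub>m M \<in> sym_mats n" using cM sym_mats_index[OF M] by (intro sym_matsI) auto
    fix v :: "real vec" assume v: "v \<in> carrier_vec n" "z \<bullet> v = 0"
    have mult: "(s \<cdot>\<^sub>m M) *\<^sub>v u = s \<cdot>\<^sub>v (M *\<^sub>v u)" if "u \<in> carrier_vec n" for u
      using cM that by (intro eq_vecI) auto
    have "v \<bullet> (candidate_slack n (s \<cdot>\<^sub>m M) z *\<^sub>v v) = s * (v \<bullet> (candidate_slack n M z *\<^sub>v v))"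
      using cM v z by (simp add: candidate_slack_form mult sum_distrib_left algebra_simps)
    then show "s * \<mu> * (v \<bullet> v) \<le> v \<bullet> (candidate_slack n (s \<cdot>\<^sub>m M) z *\<^sub>v v)"
      using form[OF v] assms(2) by (simp add: mult.assoc)
  qed (use z z_sign \<mu> n2 assms(2) in auto)
qed

text \<open>A rank-one signal \<open>\<delta> z z\<^sup>T\<close> plus a symmetric noise matrix \<open>W\<close>: the slack matrix is
  \<open>\<delta> (n I - z z\<^sup>T) + Diag (z\<^sub>i (W z)\<^sub>i) - W\<close>, and each of the two noise terms costs at most \<open>T\<close>.\<close>

lemma certified_labels_noise:
  assumes M: "M \<in> carrier_mat n n" and W: "W \<in> sym_mats n"
    and dec: "\<And>i j. i < n \<Longrightarrow> j < n \<Longrightarrow> M $$ (i, j) = \<delta> * (z $ i * z $ j) + W $$ (i, j)"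
    and z: "z \<in> carrier_vec n" and z_sign: "\<And>i. i < n \<Longrightarrow> z $ i \<in> {-1, 1}" and n2: "n \<ge> 2"
    and rows: "\<And>i. i < n \<Longrightarrow> \<bar>(W *\<^sub>v z) $ i\<bar> \<le> T"
    and norm: "\<And>v. v \<in> carrier_vec n \<Longrightarrow> \<bar>v \<bullet> (W *\<^sub>v v)\<bar> \<le> T * (v \<bullet> v)"
    and gap: "\<delta> * n - 2 * T > 0"
  shows "certified_labels n M z (\<delta> * n - 2 * T)"
proof
  have cW: "W \<in> carrier_mat n n" using W by (rule sym_mats_carrier)
  show "M \<in> sym_mats n"
    using M dec sym_mats_index[OF W] by (intro sym_matsI) (auto simp: mult_ac)
  fix v :: "real vec" assume v: "v \<in> carrier_vec n" "z \<bullet> v = 0"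
  have zz: "z $ i * z $ i = 1" if "i < n" for i using z_sign[OF that] by auto
  have Mu: "(M *\<^sub>v u) $ i = \<delta> * z $ i * (z \<bullet> u) + (W *\<^sub>v u) $ i" if "i < n" "u \<in> carrier_vec n" for i u
    unfolding mult_mat_vec_sum[OF M that(2,1)] mult_mat_vec_sum[OF cW that(2,1)]
      scalar_prod_sum[OF that(2)]
      sum_distrib_left sum.distrib[symmetric]
    using that by (intro sum.cong refl) (simp add: dec algebra_simps)
  have zn: "z \<bullet> z = real n" using z by (simp add: scalar_prod_sum[of _ n] zz)
  have "v \<bullet> (M *\<^sub>v v) = v \<bullet> (W *\<^sub>v v)"
    using M cW v by (subst (1 2) scalar_prod_sum[of _ n]) (auto simp: Mu simp del: index_mult_mat_vec)
  also have "\<dots> \<le> T * (v \<bullet> v)" using norm[OF v(1)] by linarith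
  finally have 1: "v \<bullet> (M *\<^sub>v v) \<le> T * (v \<bullet> v)" .
  have "(\<delta> * n - T) * (v \<bullet> v) = (\<Sum>i<n. (\<delta> * n - T) * (v $ i)\<^sup>2)"
    using v by (simp add: scalar_prod_sum[of _ n] sum_distrib_left power2_eq_square)
  also have "\<dots> \<le> (\<Sum>i<n. z $ i * (M *\<^sub>v z) $ i * (v $ i)\<^sup>2)"
  proof (intro sum_mono mult_right_mono)
    fix i assume "i \<in> {..<n}"
    then have i: "i < n" by simp
    have "z $ i * (M *\<^sub>v z) $ i = (z $ i * z $ i) * \<delta> * n + z $ i * (W *\<^sub>v z) $ i"
      unfolding Mu[OF i z] zn by (simp only: algebra_simps)
    also have "\<dots> = \<delta> * n + z $ i * (W *\<^sub>v z) $ i" using zz[OF i] by (simp del: index_mult_mat_vec)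
    also have "\<dots> \<ge> \<delta> * n - T"
      using rows[OF i] z_sign[OF i] by (auto simp del: index_mult_mat_vec)
    finally show "\<delta> * n - T \<le> z $ i * (M *\<^sub>v z) $ i" .
  qed simp
  finally show "(\<delta> * n - 2 * T) * (v \<bullet> v) \<le> v \<bullet> (candidate_slack n M z *\<^sub>v v)"
    using 1 candidate_slack_form[OF M z v(1)] by (simp add: algebra_simps)
qed (use z z_sign gap n2 in auto)

section \<open>Bounding a quadratic form by the trace of a power\<close>

lemma scalar_prod_Cauchy_Schwarz:
  assumes "v \<in> carrier_vec n" "w \<in> carrier_vec n"
  shows "(v \<bullet> w)\<^sup>2 \<le> (v \<bullet> v) * (w \<bullet> (w :: real vec))"
  using Cauchy_Schwarz_ineq_sum[of "\<lambda>i. v $ i" "\<lambda>i. w $ i" "{..<n}"] assms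
  by (simp add: scalar_prod_sum[of _ n] power2_eq_square)

lemma pow_mat_add:
  assumes "A \<in> carrier_mat n n"
  shows "A ^\<^sub>m (k + l) = A ^\<^sub>m k * A ^\<^sub>m l"
proof (induction l)
  case 0
  then show ?case using assms by (simp add: right_mult_one_mat[of _ n n])
next
  case (Suc l)
  then show ?case using assms by (simp add: assoc_mult_mat[of _ n n _ n _ n])
qed

lemma sym_mats_square: "A \<in> sym_mats n \<Longrightarrow> A * A \<in> sym_mats n"
  by (auto simp: sym_mats_def transpose_mult)

lemma pow_mat_power2_Suc:
  "A \<in> carrier_mat n n \<Longrightarrow> A ^\<^sub>m (2 ^ Suc m) = A ^\<^sub>m (2 ^ m) * A ^\<^sub>m (2 ^ m)"
  by (simp only: power_Suc mult_2 pow_mat_add)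

lemma sym_mats_pow:
  assumes "A \<in> sym_mats n"
  shows "A ^\<^sub>m (2 ^ m) \<in> sym_mats n"
proof (induction m)
  case 0
  then show ?case using assms by (auto simp: sym_mats_def)
next
  case (Suc m)
  then show ?case
    unfolding pow_mat_power2_Suc[OF sym_mats_carrier[OF assms]] by (rule sym_mats_square)
qed

lemma sym_mat_square_trace:
  assumes "A \<in> sym_mats n"
  shows "mat_trace (A * A) = (\<Sum>i<n. \<Sum>j<n. (A $$ (i, j))\<^sup>2)"
proof -
  have c: "A \<in> carrier_mat n n" using assms by (rule sym_mats_carrier)
  have "mat_trace (A * A) = (\<Sum>i<n. \<Sum>j<n. A $$ (i, j) * A $$ (j, i))"
    using c unfolding mat_trace_def
    by (auto simp: scalar_prod_def atLeast0LessThan intro!: sum.cong)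
  also have "\<dots> = (\<Sum>i<n. \<Sum>j<n. (A $$ (i, j))\<^sup>2)"
    using sym_mats_index[OF assms] by (intro sum.cong refl) (simp add: power2_eq_square)
  finally show ?thesis .
qed

lemma frobenius_bound:
  assumes "A \<in> carrier_mat n n" "v \<in> carrier_vec n"
  shows "(A *\<^sub>v v) \<bullet> (A *\<^sub>v v) \<le> (\<Sum>i<n. \<Sum>j<n. (A $$ (i, j))\<^sup>2) * (v \<bullet> (v :: real vec))"
proof -
  have "(A *\<^sub>v v) \<bullet> (A *\<^sub>v v) = (\<Sum>i<n. (\<Sum>j<n. A $$ (i, j) * v $ j)\<^sup>2)"
    using assms by (subst scalar_prod_sum[of _ n])
      (auto simp: mult_mat_vec_sum power2_eq_square simp del: index_mult_mat_vec)
  also have "\<dots> \<le> (\<Sum>i<n. (\<Sum>j<n. (A $$ (i, j))\<^sup>2) * (\<Sum>j<n. (v $ j)\<^sup>2))"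
    by (intro sum_mono Cauchy_Schwarz_ineq_sum)
  also have "\<dots> = (\<Sum>i<n. \<Sum>j<n. (A $$ (i, j))\<^sup>2) * (v \<bullet> v)"
    using assms by (simp add: scalar_prod_sum[of _ n] sum_distrib_right power2_eq_square)
  finally show ?thesis .
qed

lemma repeated_squaring:
  assumes A: "A \<in> sym_mats n" and v: "v \<in> carrier_vec n"
  shows "((A *\<^sub>v v) \<bullet> (A *\<^sub>v v)) ^ (2 ^ m)
    \<le> (v \<bullet> v) ^ (2 ^ m - 1) * ((A ^\<^sub>m (2 ^ m) *\<^sub>v v) \<bullet> (A ^\<^sub>m (2 ^ m) *\<^sub>v v))"
proof (induction m)
  case 0
  then show ?case using sym_mats_carrier[OF A] by simp
next
  case (Suc m)
  let ?B = "A ^\<^sub>m (2 ^ m)" and ?C = "A ^\<^sub>m (2 ^ Suc m)"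
  have sB: "?B \<in> sym_mats n" using A by (rule sym_mats_pow)
  have cB: "?B \<in> carrier_mat n n" using sB by (rule sym_mats_carrier)
  have C: "?C = ?B * ?B" using pow_mat_power2_Suc[OF sym_mats_carrier[OF A]] .
  have Bv: "?B *\<^sub>v v \<in> carrier_vec n" using cB v by simp
  have Cv: "?C *\<^sub>v v \<in> carrier_vec n" unfolding C using cB v by simp
  have "(?B *\<^sub>v v) \<bullet> (?B *\<^sub>v v) = v \<bullet> (?C *\<^sub>v v)"
    unfolding C using sym_mats_adjoint[OF sB v Bv] cB v by simp
  then have sq: "((?B *\<^sub>v v) \<bullet> (?B *\<^sub>v v))\<^sup>2 \<le> (v \<bullet> v) * ((?C *\<^sub>v v) \<bullet> (?C *\<^sub>v v))"
    using scalar_prod_Cauchy_Schwarz[OF v Cv] by simp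
  have "((A *\<^sub>v v) \<bullet> (A *\<^sub>v v)) ^ (2 ^ Suc m) = (((A *\<^sub>v v) \<bullet> (A *\<^sub>v v)) ^ (2 ^ m))\<^sup>2"
    by (simp flip: power_mult add: mult.commute)
  also have "\<dots> \<le> ((v \<bullet> v) ^ (2 ^ m - 1) * ((?B *\<^sub>v v) \<bullet> (?B *\<^sub>v v)))\<^sup>2"
    by (intro power_mono Suc.IH zero_le_power scalar_prod_self_nonneg)
  also have "\<dots> = (v \<bullet> v) ^ (2 * (2 ^ m - 1)) * ((?B *\<^sub>v v) \<bullet> (?B *\<^sub>v v))\<^sup>2"
    by (simp add: power_mult_distrib mult.commute flip: power_mult)
  also have "\<dots> \<le> (v \<bullet> v) ^ (2 * (2 ^ m - 1)) * ((v \<bullet> v) * ((?C *\<^sub>v v) \<bullet> (?C *\<^sub>v v)))"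
    by (intro mult_left_mono sq zero_le_power scalar_prod_self_nonneg)
  also have "\<dots> = (v \<bullet> v) ^ Suc (2 * (2 ^ m - 1)) * ((?C *\<^sub>v v) \<bullet> (?C *\<^sub>v v))"
    by (simp only: power_Suc2 mult.assoc)
  also have "Suc (2 * (2 ^ m - 1)) = 2 ^ Suc m - (1 :: nat)"
    by (cases "2 ^ m :: nat") simp_all
  finally show ?case .
qed

text \<open>For exponents that are powers of two, repeated squaring takes the place of the spectral
  theorem in the bound of the operator norm by the trace of an even power.\<close>

lemma quadratic_form_le_trace_power:
  assumes A: "A \<in> sym_mats n" and v: "v \<in> carrier_vec n" and T: "T \<ge> 0"
    and tr: "mat_trace (A ^\<^sub>m (2 * 2 ^ m)) \<le> T ^ (2 * 2 ^ m)"
  shows "\<bar>v \<bullet> (A *\<^sub>v v)\<bar> \<le> T * (v \<bullet> v)"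
proof -
  let ?k = "2 ^ m :: nat" and ?B = "A ^\<^sub>m (2 ^ m)"
  have cA: "A \<in> carrier_mat n n" using A by (rule sym_mats_carrier)
  have Av: "A *\<^sub>v v \<in> carrier_vec n" using cA v by simp
  have vv: "0 \<le> v \<bullet> v" by (rule scalar_prod_self_nonneg)
  have k1: "?k \<ge> 1" by simp
  have "mat_trace (A ^\<^sub>m (2 * 2 ^ m)) = (\<Sum>i<n. \<Sum>j<n. (?B $$ (i, j))\<^sup>2)"
    using sym_mat_square_trace[OF sym_mats_pow[OF A]] pow_mat_power2_Suc[OF cA, of m] by simp
  then have F: "(\<Sum>i<n. \<Sum>j<n. (?B $$ (i, j))\<^sup>2) \<le> (T\<^sup>2) ^ ?k"
    using tr by (simp add: power_mult)
  have "((A *\<^sub>v v) \<bullet> (A *\<^sub>v v)) ^ ?k \<le> (v \<bullet> v) ^ (?k - 1) * ((?B *\<^sub>v v) \<bullet> (?B *\<^sub>v v))"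
    by (rule repeated_squaring[OF A v])
  also have "\<dots> \<le> (v \<bullet> v) ^ (?k - 1) * ((T\<^sup>2) ^ ?k * (v \<bullet> v))"
    using order.trans[OF frobenius_bound[OF pow_carrier_mat[OF cA] v] mult_right_mono[OF F vv]] vv
    by (intro mult_left_mono) auto
  also have "\<dots> = (T\<^sup>2) ^ ?k * (v \<bullet> v) ^ Suc (?k - 1)"
    by (simp only: power_Suc mult_ac)
  also have "\<dots> = (T\<^sup>2 * (v \<bullet> v)) ^ ?k" using k1 by (simp only: Suc_diff_1 power_mult_distrib)
  finally have le: "((A *\<^sub>v v) \<bullet> (A *\<^sub>v v)) ^ ?k \<le> (T\<^sup>2 * (v \<bullet> v)) ^ ?k" .
  have "(A *\<^sub>v v) \<bullet> (A *\<^sub>v v) \<le> T\<^sup>2 * (v \<bullet> v)"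
    by (rule power_le_imp_le_base[of _ "?k - 1"]) (use le k1 vv in auto)
  then have "(v \<bullet> v) * ((A *\<^sub>v v) \<bullet> (A *\<^sub>v v)) \<le> (T * (v \<bullet> v))\<^sup>2"
    using mult_left_mono[OF _ vv, of "(A *\<^sub>v v) \<bullet> (A *\<^sub>v v)" "T\<^sup>2 * (v \<bullet> v)"]
    by (simp add: power2_eq_square mult_ac)
  then have "(v \<bullet> (A *\<^sub>v v))\<^sup>2 \<le> (T * (v \<bullet> v))\<^sup>2"
    using scalar_prod_Cauchy_Schwarz[OF v Av] by linarith
  then show ?thesis
    using T vv abs_le_square_iff[of "v \<bullet> (A *\<^sub>v v)" "T * (v \<bullet> v)"] by (simp add: abs_mult)
qed

section \<open>Moments of polynomials in centred Bernoulli variables\<close>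

text \<open>The centred indicator \<open>f e - r e\<close>, extended by \<open>0\<close> to indices \<open>e\<close> without a variable.\<close>

definition centred :: "'e set \<Rightarrow> ('e \<Rightarrow> real) \<Rightarrow> 'e \<Rightarrow> ('e \<Rightarrow> bool) \<Rightarrow> real" where
  "centred V r e f = (if e \<in> V then of_bool (f e) - r e else 0)"

lemma centred_bernoulli_moment:
  fixes r p :: real
  assumes "0 \<le> r" "r \<le> p" "r \<le> 1" "m \<ge> 1"
  shows "\<bar>measure_pmf.expectation (bernoulli_pmf r) (\<lambda>b. (of_bool b - r) ^ m)\<bar>
    \<le> (if m = 1 then 0 else p)"
proof -
  have E: "measure_pmf.expectation (bernoulli_pmf r) (\<lambda>b. (of_bool b - r) ^ m)
      = r * (1 - r) ^ m + (1 - r) * (- r) ^ m"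
    using assms by (simp add: mult.commute)
  show ?thesis
  proof (cases "m = 1")
    case True
    then show ?thesis unfolding E by (simp add: algebra_simps)
  next
    case False
    then have "m = Suc (Suc (m - 2))" using assms by simp
    then obtain j where m: "m = Suc (Suc j)" ..
    have "\<bar>r * (1 - r) ^ m + (1 - r) * (- r) ^ m\<bar> \<le> r * (1 - r) ^ m + (1 - r) * r ^ m"
      using assms by (intro order.trans[OF abs_triangle_ineq]) (simp add: abs_mult power_abs)
    also have "\<dots> = r * (1 - r) * ((1 - r) * (1 - r) ^ j + r * r ^ j)"
      by (simp add: m algebra_simps)
    also have "\<dots> \<le> r * (1 - r) * ((1 - r) * 1 + r * 1)"
      using assms by (intro mult_left_mono add_mono power_le_one) auto
    also have "\<dots> \<le> r" using assms by (simp add: mult_left_le)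
    also have "\<dots> \<le> p" by fact
    finally show ?thesis using False unfolding E by simp
  qed
qed

lemma prod_list_prod_count:
  fixes w :: "'e \<Rightarrow> real"
  assumes "finite V" "set es \<subseteq> V"
  shows "prod_list (map w es) = (\<Prod>e\<in>V. w e ^ count_list es e)"
  using assms(2)
proof (induction es)
  case (Cons a es)
  have "(\<Prod>e\<in>V. w e ^ count_list (a # es) e) = (\<Prod>e\<in>V. (if e = a then w a else 1) * w e ^ count_list es e)"
    by (intro prod.cong) auto
  also have "\<dots> = w a * (\<Prod>e\<in>V. w e ^ count_list es e)"
    using Cons.prems assms(1) by (simp add: prod.distrib)
  finally show ?case using Cons by simp
qed simp

text \<open>Independent Bernoulli variables indexed by a finite set, with success probabilities
  \<open>r e \<le> p\<close>.\<close>

locale bernoulli_family =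
  fixes V :: "'e set" and r :: "'e \<Rightarrow> real" and p :: real
  assumes fin: "finite V" and r0: "e \<in> V \<Longrightarrow> 0 \<le> r e" and rp: "e \<in> V \<Longrightarrow> r e \<le> p"
    and p1: "p \<le> 1" and p0: "0 < p"
begin

abbreviation "\<Omega> \<equiv> Pi_pmf V False (\<lambda>e. bernoulli_pmf (r e))"
abbreviation "w \<equiv> centred V r"

lemma finite_Omega: "finite (set_pmf \<Omega>)"
  by (rule finite_subset[OF set_Pi_pmf_subset'[OF fin]]) (intro finite_PiE_dflt fin, auto)

lemma integrable_Omega [simp]: "integrable (measure_pmf \<Omega>) (g :: _ \<Rightarrow> real)"
  by (intro integrable_measure_pmf_finite finite_Omega)

lemma expectation_prod_centred:
  assumes "set es \<subseteq> V"
  shows "measure_pmf.expectation \<Omega> (\<lambda>f. prod_list (map (\<lambda>e. w e f) es))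
     = (\<Prod>e\<in>V. measure_pmf.expectation (bernoulli_pmf (r e)) (\<lambda>b. (of_bool b - r e) ^ count_list es e))"
proof -
  have "measure_pmf.expectation \<Omega> (\<lambda>f. prod_list (map (\<lambda>e. w e f) es))
     = measure_pmf.expectation \<Omega> (\<lambda>f. \<Prod>e\<in>V. (of_bool (f e) - r e) ^ count_list es e)"
    by (simp add: prod_list_prod_count[OF fin assms] centred_def)
  also have "\<dots> = (\<Prod>e\<in>V. measure_pmf.expectation \<Omega> (\<lambda>f. (of_bool (f e) - r e) ^ count_list es e))"
  proof (rule prob_space.indep_vars_lebesgue_integral[OF measure_pmf.prob_space_axioms fin])
    show "prob_space.indep_vars (measure_pmf \<Omega>) (\<lambda>_. borel)
        (\<lambda>e f. (of_bool (f e) - r e) ^ count_list es e) V"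
      by (rule prob_space.indep_vars_compose2[OF measure_pmf.prob_space_axioms
            indep_vars_Pi_pmf[OF fin]]) auto
  qed simp
  also have "\<dots> = (\<Prod>e\<in>V. measure_pmf.expectation (map_pmf (\<lambda>f. f e) \<Omega>)
      (\<lambda>b. (of_bool b - r e) ^ count_list es e))"
    by simp
  also have "\<dots> = (\<Prod>e\<in>V. measure_pmf.expectation (bernoulli_pmf (r e))
      (\<lambda>b. (of_bool b - r e) ^ count_list es e))"
    by (intro prod.cong refl) (subst Pi_pmf_component[OF fin], simp)
  finally show ?thesis .
qed

text \<open>A product of \<open>2 * k\<close> centred variables has expectation \<open>0\<close> unless each of its indices
  occurs at least twice, and then at most \<open>k\<close> indices are distinct and the expectation is in
  absolute value at most \<open>p\<close> to the number of distinct indices. For \<open>\<mu> \<ge> 1\<close>, the factor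
  \<open>\<mu> ^ (k - d)\<close>, where \<open>d\<close> is that number, absorbs the constraint \<open>d \<le> k\<close>; the resulting bound
  is easy to sum over walks.\<close>

lemma expectation_prod_centred_le:
  assumes len: "length es = 2 * k" and lam: "\<mu> \<ge> 1"
  shows "\<bar>measure_pmf.expectation \<Omega> (\<lambda>f. prod_list (map (\<lambda>e. w e f) es))\<bar>
     \<le> \<mu> ^ k * (p / \<mu>) ^ card (set es)"
proof (cases "set es \<subseteq> V")
  case False
  then obtain e where "e \<in> set es" "e \<notin> V" by auto
  then have "0 \<in> set (map (\<lambda>e. w e f) es)" for f
    by (force simp: centred_def)
  then have "prod_list (map (\<lambda>e. w e f) es) = 0" for f
    by (simp only: prod_list_zero_iff)
  then show ?thesis using p0 lam by (simp only: integral_zero) simp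
next
  case True
  let ?c = "count_list es"
  have "\<bar>measure_pmf.expectation \<Omega> (\<lambda>f. prod_list (map (\<lambda>e. w e f) es))\<bar>
     = (\<Prod>e\<in>V. \<bar>measure_pmf.expectation (bernoulli_pmf (r e)) (\<lambda>b. (of_bool b - r e) ^ ?c e)\<bar>)"
    by (simp only: expectation_prod_centred[OF True] abs_prod)
  also have "\<dots> \<le> (\<Prod>e\<in>V. if ?c e = 0 then 1 else if ?c e = 1 then 0 else p)"
  proof (intro prod_mono conjI)
    fix e assume "e \<in> V"
    then have "0 \<le> r e" "r e \<le> p" "r e \<le> 1" using r0 rp p1 by force+
    then show "\<bar>measure_pmf.expectation (bernoulli_pmf (r e)) (\<lambda>b. (of_bool b - r e) ^ ?c e)\<bar>
       \<le> (if ?c e = 0 then 1 else if ?c e = 1 then 0 else p)"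
      using centred_bernoulli_moment[of "r e" p "?c e"] by (cases "?c e = 0") auto
  qed simp
  also have "\<dots> = (\<Prod>e\<in>set es. if ?c e = 1 then 0 else p)"
    using True by (intro prod.mono_neutral_cong_right fin) (auto simp: count_list_0_iff)
  also have "\<dots> \<le> \<mu> ^ k * (p / \<mu>) ^ card (set es)"
  proof (cases "\<exists>e\<in>set es. ?c e = 1")
    case True
    then have "(\<Prod>e\<in>set es. if ?c e = 1 then 0 else p) = 0" by (intro prod_zero) auto
    then show ?thesis using p0 lam by (simp only:) simp
  next
    case False
    then have c2: "?c e \<ge> 2" if "e \<in> set es" for e
      using that False count_list_0_iff[of es e] by (cases "?c e"; cases "?c e - 1") auto
    have "2 * card (set es) = (\<Sum>e\<in>set es. 2)" by simp
    also have "\<dots> \<le> (\<Sum>e\<in>set es. ?c e)" by (intro sum_mono c2)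
    also have "\<dots> = 2 * k" using len by (simp add: sum_count_set)
    finally have d: "card (set es) \<le> k" by simp
    have "(\<Prod>e\<in>set es. if ?c e = 1 then 0 else p) = p ^ card (set es)"
      using False by simp
    also have "\<dots> = \<mu> ^ card (set es) * (p / \<mu>) ^ card (set es)"
      using lam by (simp add: power_divide)
    also have "\<dots> \<le> \<mu> ^ k * (p / \<mu>) ^ card (set es)"
      using lam d p0 by (intro mult_right_mono power_increasing) auto
    finally show ?thesis .
  qed
  finally show ?thesis .
qed

text \<open>\<open>G L u\<close> is a weighted sum over walks of length \<open>L\<close> from \<open>u\<close>, where a step from \<open>u\<close> to
  \<open>l\<close> contributes the variable \<open>step u l\<close>, and \<open>es\<close> lists the variables collected so far. Each
  step either uses one of at most \<open>2 * k\<close> collected variables, or one of at most \<open>n\<close> new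
  variables at the price of a factor \<open>p / \<mu>\<close>; this is the factor \<open>n p / \<mu> + 2 k\<close> per step.\<close>

lemma walk_moment_step_le:
  fixes G :: "nat \<Rightarrow> nat \<Rightarrow> ('e \<Rightarrow> bool) \<Rightarrow> real" and step :: "nat \<Rightarrow> nat \<Rightarrow> 'e"
  assumes G0: "\<And>u. u < n \<Longrightarrow> \<exists>c. \<bar>c\<bar> \<le> 1 \<and> (\<forall>f. G 0 u f = c)"
    and GS: "\<And>L u f. u < n \<Longrightarrow> G (Suc L) u f = (\<Sum>l<n. a u l * w (step u l) f * G L l f)"
    and a: "\<And>u l. u < n \<Longrightarrow> l < n \<Longrightarrow> \<bar>a u l\<bar> \<le> 1"
    and inj: "\<And>u. u < n \<Longrightarrow> inj_on (step u) {..<n}"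
    and lam: "\<mu> \<ge> 1"
    and "u < n" "length es + L = 2 * k"
  shows "\<bar>measure_pmf.expectation \<Omega> (\<lambda>f. prod_list (map (\<lambda>e. w e f) es) * G L u f)\<bar>
     \<le> \<mu> ^ k * (p / \<mu>) ^ card (set es) * (real n * p / \<mu> + 2 * real k) ^ L"
  using assms(6,7)
proof (induction L arbitrary: u es)
  case 0
  then obtain c where c: "\<bar>c\<bar> \<le> 1" "\<And>f. G 0 u f = c" using G0 by metis
  have "\<bar>measure_pmf.expectation \<Omega> (\<lambda>f. prod_list (map (\<lambda>e. w e f) es) * G 0 u f)\<bar>
    = \<bar>measure_pmf.expectation \<Omega> (\<lambda>f. prod_list (map (\<lambda>e. w e f) es))\<bar> * \<bar>c\<bar>"
    by (simp add: c abs_mult)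
  also have "\<dots> \<le> (\<mu> ^ k * (p / \<mu>) ^ card (set es)) * 1"
    using 0 c lam p0 by (intro mult_mono expectation_prod_centred_le) auto
  finally show ?case by simp
next
  case (Suc L)
  let ?R = "real n * p / \<mu> + 2 * real k" and ?B = "\<mu> ^ k * (p / \<mu>) ^ card (set es)"
  have R0: "0 \<le> ?R" "0 \<le> ?B" using p0 lam by auto
  have "(\<lambda>f. prod_list (map (\<lambda>e. w e f) es) * G (Suc L) u f)
     = (\<lambda>f. \<Sum>l<n. a u l * (prod_list (map (\<lambda>e. w e f) (step u l # es)) * G L l f))"
    using Suc.prems by (simp add: GS sum_distrib_left mult_ac)
  then have "\<bar>measure_pmf.expectation \<Omega> (\<lambda>f. prod_list (map (\<lambda>e. w e f) es) * G (Suc L) u f)\<bar>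
    = \<bar>\<Sum>l<n. a u l * measure_pmf.expectation \<Omega>
        (\<lambda>f. prod_list (map (\<lambda>e. w e f) (step u l # es)) * G L l f)\<bar>"
    by (simp del: list.map prod_list.Cons)
  also have "\<dots> \<le> (\<Sum>l<n. \<bar>a u l\<bar> * \<bar>measure_pmf.expectation \<Omega>
        (\<lambda>f. prod_list (map (\<lambda>e. w e f) (step u l # es)) * G L l f)\<bar>)"
    by (intro order.trans[OF sum_abs] sum_mono) (simp add: abs_mult)
  also have "\<dots> \<le> (\<Sum>l<n. 1 * (\<mu> ^ k * (p / \<mu>) ^ card (set (step u l # es)) * ?R ^ L))"
    using Suc.prems a by (intro sum_mono mult_mono Suc.IH) auto
  also have "\<dots> \<le> (\<Sum>l<n. ?B * ?R ^ L * (of_bool (step u l \<in> set es) + p / \<mu>))"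
  proof (intro sum_mono)
    fix l
    have "(p / \<mu>) ^ card (set (step u l # es))
        \<le> (p / \<mu>) ^ card (set es) * (of_bool (step u l \<in> set es) + p / \<mu>)"
      using p0 lam by (cases "step u l \<in> set es") (simp_all add: insert_absorb distrib_left mult.commute)
    then have "\<mu> ^ k * ?R ^ L * (p / \<mu>) ^ card (set (step u l # es))
        \<le> \<mu> ^ k * ?R ^ L
          * ((p / \<mu>) ^ card (set es) * (of_bool (step u l \<in> set es) + p / \<mu>))"
      using R0 lam by (intro mult_left_mono) auto
    then show "1 * (\<mu> ^ k * (p / \<mu>) ^ card (set (step u l # es)) * ?R ^ L)
        \<le> ?B * ?R ^ L * (of_bool (step u l \<in> set es) + p / \<mu>)"
      by (simp only: mult_ac mult_1)
  qed
  also have "\<dots> = ?B * ?R ^ L * (real (card {l\<in>{..<n}. step u l \<in> set es}) + n * p / \<mu>)"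
  proof -
    have "(\<Sum>l<n. of_bool (step u l \<in> set es) :: real) = real (card {l\<in>{..<n}. step u l \<in> set es})"
      by (simp add: of_bool_def sum.If_cases Int_def)
    then show ?thesis
      by (simp add: sum_distrib_left[symmetric] sum.distrib)
  qed
  also have "\<dots> \<le> ?B * ?R ^ L * ?R"
  proof (intro mult_left_mono)
    have "card {l\<in>{..<n}. step u l \<in> set es} \<le> card (set es)"
      using inj[OF \<open>u < n\<close>] by (intro card_inj_on_le[of "step u"]) (auto intro: inj_on_subset)
    also have "\<dots> \<le> 2 * k" using card_length[of es] Suc.prems by simp
    finally show "real (card {l\<in>{..<n}. step u l \<in> set es}) + n * p / \<mu> \<le> ?R" by simp
  qed (use R0 in auto)
  finally show ?case by (simp add: mult_ac)
qed

text \<open>With \<open>G\<close> as in the preceding lemma and no variable collected at the start.\<close>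

lemma walk_moment_le:
  fixes G :: "nat \<Rightarrow> nat \<Rightarrow> ('e \<Rightarrow> bool) \<Rightarrow> real" and step :: "nat \<Rightarrow> nat \<Rightarrow> 'e"
  assumes G0: "\<And>u. u < n \<Longrightarrow> \<exists>c. \<bar>c\<bar> \<le> 1 \<and> (\<forall>f. G 0 u f = c)"
    and GS: "\<And>L u f. u < n \<Longrightarrow> G (Suc L) u f = (\<Sum>l<n. a u l * w (step u l) f * G L l f)"
    and a: "\<And>u l. u < n \<Longrightarrow> l < n \<Longrightarrow> \<bar>a u l\<bar> \<le> 1"
    and inj: "\<And>u. u < n \<Longrightarrow> inj_on (step u) {..<n}"
    and u: "u < n" and k: "1 \<le> k" "2 * real k \<le> real n * p"
  shows "measure_pmf.expectation \<Omega> (G (2 * k) u) \<le> (8 * real k * real n * p) ^ k"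
proof -
  \<comment> \<open>This value of \<open>\<mu>\<close> balances the two kinds of steps.\<close>
  define \<mu> where "\<mu> = real n * p / (2 * real k)"
  have mu: "\<mu> \<ge> 1" using k by (simp add: \<mu>_def)
  have n: "n > 0" using u by simp
  have e: "real n * p / \<mu> = 2 * real k" using n k p0 by (simp add: \<mu>_def)
  have "measure_pmf.expectation \<Omega> (G (2 * k) u) \<le> \<mu> ^ k * (4 * real k) ^ (2 * k)"
    using walk_moment_step_le[of n G a step \<mu> u "[]" "2 * k" k, OF G0 GS a inj mu u] unfolding e by simp
  also have "\<dots> = (\<mu> * (4 * real k)\<^sup>2) ^ k" by (simp add: power_mult power_mult_distrib)
  also have "\<mu> * (4 * real k)\<^sup>2 = 8 * real k * real n * p"
    using k by (simp add: \<mu>_def power2_eq_square)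
  finally show ?thesis .
qed

end

section \<open>The noise matrix of the block model\<close>

text \<open>The pair that indexes the variable of the undirected edge between \<open>i\<close> and \<open>j\<close>. The pairs
  \<open>edge i i\<close> index no variable.\<close>

definition edge :: "nat \<Rightarrow> nat \<Rightarrow> nat \<times> nat" where
  "edge i j = (min i j, max i j)"

lemma edge_commute: "edge i j = edge j i"
  by (simp add: edge_def min.commute max.commute)

lemma inj_on_edge: "inj_on (edge i) A"
  by (auto simp: inj_on_def edge_def min_def max_def split: if_splits)

text \<open>The centred adjacency matrix; its diagonal vanishes because \<open>centred\<close> is \<open>0\<close> outside the
  vertex pairs.\<close>

definition noise_mat :: "nat \<Rightarrow> (nat \<times> nat \<Rightarrow> real) \<Rightarrow> (nat \<times> nat \<Rightarrow> bool) \<Rightarrow> real mat" where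
  "noise_mat n r f = mat n n (\<lambda>(i, j). centred (vertex_pairs n) r (edge i j) f)"

lemma noise_mat_sym: "noise_mat n r f \<in> sym_mats n"
  by (intro sym_matsI) (auto simp: noise_mat_def edge_commute)

lemma noise_mat_carrier: "noise_mat n r f \<in> carrier_mat n n"
  by (simp add: noise_mat_def)

text \<open>For symmetric \<open>W\<close>, a nonnegative statistic that controls both noise terms of the
  certificate at once, the signed row sums and the operator norm, so that a single application
  of the Markov inequality suffices.\<close>

definition noise_stat :: "nat \<Rightarrow> nat \<Rightarrow> real vec \<Rightarrow> real mat \<Rightarrow> real" where
  "noise_stat n k z W = (\<Sum>i<n. ((W *\<^sub>v z) $ i) ^ (2 * k)) + mat_trace (W ^\<^sub>m (2 * k))"

lemma noise_stat_expectation: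
  assumes fam: "bernoulli_family (vertex_pairs n) r p" and z: "z \<in> carrier_vec n"
    and z1: "\<And>i. i < n \<Longrightarrow> \<bar>z $ i\<bar> \<le> 1"
    and k: "1 \<le> k" "2 * real k \<le> real n * p"
  shows "measure_pmf.expectation (Pi_pmf (vertex_pairs n) False (\<lambda>e. bernoulli_pmf (r e)))
      (\<lambda>f. noise_stat n k z (noise_mat n r f)) \<le> 2 * real n * (8 * real k * real n * p) ^ k"
proof -
  interpret bernoulli_family "vertex_pairs n" r p by fact
  let ?W = "noise_mat n r" and ?B = "(8 * real k * real n * p) ^ k"
  \<comment> \<open>A power of a row sum is a sum over walks whose step to \<open>l\<close> always contributes \<open>edge i l\<close>.\<close>
  have row: "measure_pmf.expectation \<Omega> (\<lambda>f. ((?W f *\<^sub>v z) $ i) ^ (2 * k)) \<le> ?B" if i: "i < n" for i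
  proof (rule walk_moment_le[where n = n and u = i and G = "\<lambda>L u f. ((?W f *\<^sub>v z) $ i) ^ L"
        and step = "\<lambda>u l. edge i l" and a = "\<lambda>u l. z $ l"])
    fix L u f
    have "(?W f *\<^sub>v z) $ i = (\<Sum>l<n. z $ l * w (edge i l) f)"
      unfolding mult_mat_vec_sum[OF noise_mat_carrier z i] using i
      by (simp add: noise_mat_def mult.commute)
    then show "((?W f *\<^sub>v z) $ i) ^ Suc L = (\<Sum>l<n. z $ l * w (edge i l) f * ((?W f *\<^sub>v z) $ i) ^ L)"
      by (simp add: sum_distrib_right del: index_mult_mat_vec)
  qed (use z1 i k inj_on_edge in \<open>auto intro!: exI[of _ "1 :: real"]\<close>)
  have diag: "measure_pmf.expectation \<Omega> (\<lambda>f. (?W f ^\<^sub>m (2 * k)) $$ (i, i)) \<le> ?B" if i: "i < n" for i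
  proof (rule walk_moment_le[where n = n and u = i and G = "\<lambda>L u f. (?W f ^\<^sub>m L) $$ (i, u)"
        and step = edge and a = "\<lambda>u l. 1"])
    fix u assume u: "u < n"
    then show "\<exists>c. \<bar>c\<bar> \<le> 1 \<and> (\<forall>f. (?W f ^\<^sub>m 0) $$ (i, u) = c)"
      using i by (intro exI[of _ "of_bool (i = u)"]) (auto simp: noise_mat_def)
    fix L f
    have c: "?W f ^\<^sub>m L \<in> carrier_mat n n" using noise_mat_carrier by simp
    have "(?W f ^\<^sub>m Suc L) $$ (i, u) = (\<Sum>l<n. (?W f ^\<^sub>m L) $$ (i, l) * ?W f $$ (l, u))"
      using c i u noise_mat_carrier[of n r f] by (simp add: scalar_prod_def atLeast0LessThan)
    also have "\<dots> = (\<Sum>l<n. 1 * w (edge u l) f * (?W f ^\<^sub>m L) $$ (i, l))"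
      using u by (intro sum.cong refl) (simp add: noise_mat_def edge_commute[of u])
    finally show "(?W f ^\<^sub>m Suc L) $$ (i, u) = (\<Sum>l<n. 1 * w (edge u l) f * (?W f ^\<^sub>m L) $$ (i, l))" .
  qed (use i k inj_on_edge in auto)
  have "(\<lambda>f. noise_stat n k z (?W f))
      = (\<lambda>f. (\<Sum>i<n. ((?W f *\<^sub>v z) $ i) ^ (2 * k)) + (\<Sum>i<n. (?W f ^\<^sub>m (2 * k)) $$ (i, i)))"
    by (simp add: noise_stat_def mat_trace_def carrier_matD[OF noise_mat_carrier])
  then have "measure_pmf.expectation \<Omega> (\<lambda>f. noise_stat n k z (?W f))
      = (\<Sum>i<n. measure_pmf.expectation \<Omega> (\<lambda>f. ((?W f *\<^sub>v z) $ i) ^ (2 * k)))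
        + (\<Sum>i<n. measure_pmf.expectation \<Omega> (\<lambda>f. (?W f ^\<^sub>m (2 * k)) $$ (i, i)))"
    by (simp del: index_mult_mat_vec)
  also have "\<dots> \<le> (\<Sum>i<n. ?B) + (\<Sum>i<n. ?B)"
    by (intro add_mono sum_mono row diag) auto
  finally show ?thesis by simp
qed

lemma trace_even_power_nonneg:
  assumes "W \<in> sym_mats n"
  shows "0 \<le> mat_trace (W ^\<^sub>m (2 * 2 ^ m))"
  using sym_mat_square_trace[OF sym_mats_pow[OF assms]]
    pow_mat_power2_Suc[OF sym_mats_carrier[OF assms], of m]
  by (simp add: sum_nonneg)

lemma noise_stat_nonneg:
  assumes "W \<in> sym_mats n"
  shows "0 \<le> noise_stat n (2 ^ m) z W"
  unfolding noise_stat_def using trace_even_power_nonneg[OF assms, of m]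
  by (intro add_nonneg_nonneg sum_nonneg) (simp_all add: power_mult del: index_mult_mat_vec)

lemma noise_stat_small:
  assumes W: "W \<in> sym_mats n" and T: "T \<ge> 0" and small: "noise_stat n (2 ^ m) z W \<le> T ^ (2 * 2 ^ m)"
  shows "i < n \<Longrightarrow> \<bar>(W *\<^sub>v z) $ i\<bar> \<le> T"
    and "v \<in> carrier_vec n \<Longrightarrow> \<bar>v \<bullet> (W *\<^sub>v v)\<bar> \<le> T * (v \<bullet> v)"
proof -
  let ?S = "\<lambda>i. ((W *\<^sub>v z) $ i) ^ (2 * 2 ^ m)"
  note tr0 = trace_even_power_nonneg[OF W, of m]
  have S0: "0 \<le> ?S i" for i by (simp add: power_mult del: index_mult_mat_vec)
  then have sum0: "0 \<le> (\<Sum>i<n. ?S i)" by (intro sum_nonneg)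
  show "\<bar>v \<bullet> (W *\<^sub>v v)\<bar> \<le> T * (v \<bullet> v)" if "v \<in> carrier_vec n"
    using small sum0
    by (intro quadratic_form_le_trace_power[OF W that T, of m]) (simp add: noise_stat_def)
  assume i: "i < n"
  have "?S i \<le> (\<Sum>i<n. ?S i)" using i S0 by (intro member_le_sum) auto
  also have "\<dots> \<le> T ^ (2 * 2 ^ m)" using small tr0 by (simp add: noise_stat_def)
  finally have "\<bar>(W *\<^sub>v z) $ i\<bar> ^ (2 * 2 ^ m) \<le> T ^ (2 * 2 ^ m)"
    by (simp add: power_even_abs del: index_mult_mat_vec)
  then show "\<bar>(W *\<^sub>v z) $ i\<bar> \<le> T"
    using T power_mono_iff[of "\<bar>(W *\<^sub>v z) $ i\<bar>" T "2 * 2 ^ m"] by (simp del: index_mult_mat_vec)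
qed

text \<open>The diagonal value \<open>(p - q) / 2\<close> is the one that makes the expectation exactly
  \<open>(p - q) / 2 * (z z\<^sup>T)\<close>.\<close>

lemma adj_mat_signal_plus_noise:
  assumes z_sign: "\<And>i. i < n \<Longrightarrow> z $ i \<in> {-1, 1 :: real}" and ij: "i < n" "j < n"
  shows "(adj_mat_with_diag n ((p - q) / 2) {{i, j} |i j. (i, j) \<in> vertex_pairs n \<and> f (i, j)}
            - ((p + q) / 2) \<cdot>\<^sub>m offdiag_ones n) $$ (i, j)
    = (p - q) / 2 * (z $ i * z $ j)
      + noise_mat n (\<lambda>(i, j). if z $ i = z $ j then p else q) f $$ (i, j)"
proof (cases "i = j")
  case True
  then show ?thesis using ij z_sign[of i]
    by (auto simp: adj_mat_with_diag_def offdiag_ones_def noise_mat_def centred_def edge_def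
        vertex_pairs_def)
next
  case False
  have "{i, j} \<in> {{i, j} |i j. (i, j) \<in> vertex_pairs n \<and> f (i, j)} \<longleftrightarrow> f (edge i j)"
  proof
    assume "{i, j} \<in> {{i, j} |i j. (i, j) \<in> vertex_pairs n \<and> f (i, j)}"
    then obtain a b where ab: "{i, j} = {a, b}" "a < b" "f (a, b)" by (auto simp: vertex_pairs_def)
    then have "edge i j = (a, b)" by (auto simp: edge_def doubleton_eq_iff)
    then show "f (edge i j)" using ab by simp
  next
    assume "f (edge i j)"
    moreover have "edge i j \<in> vertex_pairs n" using False ij by (auto simp: edge_def vertex_pairs_def)
    moreover have "{i, j} = {min i j, max i j}" by (auto simp: min_def max_def)
    ultimately show "{i, j} \<in> {{i, j} |i j. (i, j) \<in> vertex_pairs n \<and> f (i, j)}"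
      unfolding edge_def by blast
  qed
  moreover have "edge i j \<in> vertex_pairs n" using False ij by (auto simp: edge_def vertex_pairs_def)
  moreover have "(case edge i j of (i, j) \<Rightarrow> if z $ i = z $ j then p else q)
      = (p + q) / 2 + (p - q) / 2 * (z $ i * z $ j)"
    using z_sign[OF ij(1)] z_sign[OF ij(2)]
    by (auto simp: edge_def min_def max_def field_simps)
  ultimately show ?thesis using False ij
    by (simp add: adj_mat_with_diag_def offdiag_ones_def noise_mat_def centred_def)
qed

lemma finite_vertex_pairs: "finite (vertex_pairs n)"
  by (rule finite_subset[of _ "{..<n} \<times> {..<n}"]) (auto simp: vertex_pairs_def)

section \<open>High probability\<close>

lemma power_of_two_between:
  assumes "L \<ge> (1 :: real)"
  shows "\<exists>m. L \<le> 2 ^ m \<and> 2 ^ m \<le> 2 * L"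
proof -
  obtain m0 where "L < 2 ^ m0" using real_arch_pow[of 2 L] by auto
  then have ex: "\<exists>m. L \<le> (2 :: real) ^ m" by (auto intro: less_imp_le)
  define m where "m = (LEAST m. L \<le> (2 :: real) ^ m)"
  have m: "L \<le> 2 ^ m" unfolding m_def using ex by (rule LeastI_ex)
  have "(2 :: real) ^ m \<le> 2 * L"
  proof (cases m)
    case 0
    then show ?thesis using assms by simp
  next
    case (Suc l)
    have "\<not> L \<le> 2 ^ l" using not_less_Least[of l "\<lambda>m. L \<le> (2 :: real) ^ m"] Suc by (simp add: m_def)
    then show ?thesis using Suc by simp
  qed
  then show ?thesis using m by blast
qed

text \<open>The threshold \<open>T = (p - q) n / 8\<close> is a quarter of the signal eigenvalue \<open>(p - q) n / 2\<close>.
  With \<open>k\<close> between \<open>2 ln n\<close> and \<open>4 ln n\<close>, the moment bound divided by \<open>T ^ (2 * k)\<close> is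
  \<open>2 n (512 k p / ((p - q)\<^sup>2 n)) ^ k\<close>. The signal strength \<open>64 * sqrt (ln n)\<close> makes the base at
  most \<open>1 / 4 \<le> exp (- 1)\<close>, so that the power is at most \<open>n\<close> to the \<open>- 2\<close>.\<close>

lemma noise_stat_tail:
  fixes n :: nat and p q :: real
  defines "r \<equiv> \<lambda>z :: real vec. \<lambda>(i, j). if z $ i = z $ j then p else q"
  assumes n: "ln (real n) \<ge> 1" and z: "z \<in> carrier_vec n" and z_sign: "\<And>i. i < n \<Longrightarrow> z $ i \<in> {-1, 1}"
    and pq: "0 \<le> q" "q < p" "p \<le> 1"
    and signal: "signal_strength n p q \<ge> 64 * sqrt (ln (real n))"
    and m: "2 * ln (real n) \<le> 2 ^ m" "2 ^ m \<le> 4 * ln (real n)"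
  shows "measure_pmf.prob (Pi_pmf (vertex_pairs n) False (\<lambda>e. bernoulli_pmf (r z e)))
      {f. noise_stat n (2 ^ m) z (noise_mat n (r z) f) \<ge> ((p - q) * n / 8) ^ (2 * 2 ^ m)} \<le> 2 / n"
proof -
  let ?L = "ln (real n)" and ?k = "2 ^ m :: nat" and ?T = "(p - q) * n / 8"
  have p0: "p > 0" using pq by simp
  have n0: "n > 0" using n by (cases n) auto
  have T0: "?T > 0" using pq n0 by simp
  have "(64 * sqrt ?L)\<^sup>2 \<le> (signal_strength n p q)\<^sup>2"
    using signal n by (intro power_mono) auto
  also have "\<dots> = (p - q)\<^sup>2 * n / (2 * (p + q))"
    using pq by (simp add: signal_strength_def power_mult_distrib power_divide)
  finally have sig: "8192 * (p + q) * ?L \<le> (p - q)\<^sup>2 * n"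
    using n pq by (simp add: power_mult_distrib field_simps)
  have "(p - q)\<^sup>2 \<le> p * (p + q)"
    unfolding power2_eq_square using pq by (intro mult_mono) auto
  then have "(p - q)\<^sup>2 * n \<le> p * (p + q) * n" by (intro mult_right_mono) auto
  with sig have "8192 * (p + q) * ?L \<le> p * (p + q) * n" by (rule order.trans)
  then have "(p + q) * (8192 * ?L) \<le> (p + q) * (n * p)" by (simp only: mult_ac)
  then have np: "8192 * ?L \<le> n * p" using pq p0 by (simp add: mult_le_cancel_left)
  have k: "1 \<le> ?k" "2 * real ?k \<le> n * p" using m np n by auto
  interpret bernoulli_family "vertex_pairs n" "r z" p
    using pq by unfold_locales (auto simp: r_def finite_vertex_pairs)
  let ?h = "\<lambda>f. noise_stat n ?k z (noise_mat n (r z) f)"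
  have z1: "\<bar>z $ i\<bar> \<le> 1" if "i < n" for i using z_sign[OF that] by auto
  have E: "measure_pmf.expectation \<Omega> ?h \<le> 2 * real n * (8 * real ?k * real n * p) ^ ?k"
    by (rule noise_stat_expectation[OF bernoulli_family_axioms z z1 k])
  have h0: "0 \<le> ?h f" for f
    by (rule noise_stat_nonneg[OF noise_mat_sym])
  have "measure_pmf.prob \<Omega> {f. ?h f \<ge> ?T ^ (2 * ?k)} \<le> measure_pmf.expectation \<Omega> ?h / ?T ^ (2 * ?k)"
    using integral_Markov_inequality_measure[of "measure_pmf \<Omega>" ?h "{}" "?T ^ (2 * ?k)"] T0 h0 by simp
  also have "\<dots> \<le> 2 * real n * (8 * real ?k * real n * p) ^ ?k / ?T ^ (2 * ?k)"
    using E T0 by (intro divide_right_mono) auto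
  also have "\<dots> = 2 * real n * (8 * real ?k * real n * p / ?T\<^sup>2) ^ ?k"
    by (simp only: power_mult power_divide times_divide_eq_right)
  also have "\<dots> \<le> 2 * real n * exp (- 1) ^ ?k"
  proof (intro mult_left_mono power_mono)
    have "4 * (8 * real ?k * real n * p) \<le> 4 * (8 * (4 * ?L) * real n * p)"
      using m p0 by (intro mult_left_mono mult_right_mono) auto
    also have "\<dots> = 8192 * p * ?L * n / 64" by simp
    also have "\<dots> \<le> 8192 * (p + q) * ?L * n / 64"
      using pq n by (intro divide_right_mono mult_right_mono) auto
    also have "\<dots> \<le> (p - q)\<^sup>2 * n * n / 64"
      using sig by (intro divide_right_mono mult_right_mono) auto
    also have "\<dots> = ?T\<^sup>2" by (simp add: power2_eq_square)
    finally have "8 * real ?k * real n * p / ?T\<^sup>2 \<le> 1 / 4"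
      by (subst pos_divide_le_eq[OF zero_less_power[OF T0]]) linarith
    also have "1 / 4 \<le> exp (- 1 :: real)"
    proof -
      have "exp (1 :: real) \<le> 4" using exp_le by simp
      then show ?thesis by (simp add: exp_minus field_simps)
    qed
    finally show "8 * real ?k * real n * p / ?T\<^sup>2 \<le> exp (- 1)" .
  qed (use p0 in auto)
  also have "exp (- 1 :: real) ^ ?k = exp (- real ?k)" by (simp flip: exp_of_nat_mult)
  also have "2 * real n * exp (- real ?k) \<le> 2 * real n * exp (- (2 * ?L))"
    using m by (intro mult_left_mono) auto
  also have "exp (- (2 * ?L)) = 1 / (real n)\<^sup>2"
    using n0 by (simp add: exp_minus exp_double field_simps)
  also have "2 * real n * (1 / (real n)\<^sup>2) = 2 / n" by (simp add: power2_eq_square)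
  finally show ?thesis .
qed

text \<open>Outside of the bad event, the certificate for the matrix \<open>M\<close> has gap
  \<open>(p - q) n / 2 - 2 T = (p - q) n / 4\<close>; after rescaling by \<open>2 / (p - q)\<close> it is \<open>n / 2\<close>, which
  exceeds \<open>n / 4\<close>.\<close>

theorem theorem4p2:
  shows "\<exists>C::real. C > 0 \<and> (\<exists>c::real. 0 < c \<and> c < 1 \<and>
    (\<forall>\<epsilon>::real. \<epsilon> > 0 \<longrightarrow> (\<forall>\<^sub>F n::nat in sequentially. even n \<longrightarrow>
      (\<forall>z p q. balanced_labels n z \<and> 0 \<le> q \<and> q < p \<and> p \<le> 1 \<and>
          signal_strength n p q \<ge> C * sqrt (ln (real n)) \<longrightarrow>
        measure_pmf.prob (block_model n z p q)
          {E. let A = adj_mat_with_diag n ((p - q) / 2) E;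
                  M = A - ((p + q) / 2) \<cdot>\<^sub>m offdiag_ones n;
                  At = (2 / (p - q)) \<cdot>\<^sub>m M
              in simple_sdp (max_diag_sdp n M) \<and>
                 primal_solution (max_diag_sdp n M) (self_outer z) \<and>
                 (\<exists>!y. dual_solution (max_diag_sdp n At) y) \<and>
                 (\<forall>y. dual_solution (max_diag_sdp n At) y \<longrightarrow>
                    eigval (n - 1) (- At - diag_of_vec y) > c * real n)}
        \<ge> 1 - \<epsilon>))))"
proof (rule exI[of _ "64 :: real"], rule conjI, simp,
    rule exI[of _ "1 / 4 :: real"], intro conjI allI impI)
  fix \<epsilon> :: real
  assume eps: "\<epsilon> > 0"
  have "eventually (\<lambda>n :: nat. 1 \<le> ln (real n)) sequentially"
    using filterlim_compose[OF ln_at_top filterlim_real_sequentially] by (simp add: filterlim_at_top)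
  moreover have "eventually (\<lambda>n :: nat. 2 / \<epsilon> \<le> real n) sequentially"
    using filterlim_real_sequentially by (simp add: filterlim_at_top)
  ultimately show "\<forall>\<^sub>F n::nat in sequentially. even n \<longrightarrow>
      (\<forall>z p q. balanced_labels n z \<and> 0 \<le> q \<and> q < p \<and> p \<le> 1 \<and>
          signal_strength n p q \<ge> 64 * sqrt (ln (real n)) \<longrightarrow>
        measure_pmf.prob (block_model n z p q)
          {E. let A = adj_mat_with_diag n ((p - q) / 2) E;
                  M = A - ((p + q) / 2) \<cdot>\<^sub>m offdiag_ones n;
                  At = (2 / (p - q)) \<cdot>\<^sub>m M
              in simple_sdp (max_diag_sdp n M) \<and>
                 primal_solution (max_diag_sdp n M) (self_outer z) \<and>
                 (\<exists>!y. dual_solution (max_diag_sdp n At) y) \<and>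
                 (\<forall>y. dual_solution (max_diag_sdp n At) y \<longrightarrow>
                    eigval (n - 1) (- At - diag_of_vec y) > 1 / 4 * real n)}
        \<ge> 1 - \<epsilon>)"
  proof eventually_elim
    case (elim n)
    show ?case
    proof (intro impI allI)
      fix z :: "real vec" and p q :: real
      assume hyps: "balanced_labels n z \<and> 0 \<le> q \<and> q < p \<and> p \<le> 1 \<and>
          signal_strength n p q \<ge> 64 * sqrt (ln (real n))"
      then have bal: "balanced_labels n z" and pq: "0 \<le> q" "q < p" "p \<le> 1"
        and signal: "signal_strength n p q \<ge> 64 * sqrt (ln (real n))" by auto
      have z: "z \<in> carrier_vec n" and z_sign: "\<And>i. i < n \<Longrightarrow> z $ i \<in> {-1, 1}"
        using bal by (auto simp: balanced_labels_def)
      have n2: "n \<ge> 2"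
      proof (rule ccontr)
        assume "\<not> n \<ge> 2"
        then have "n = 0 \<or> n = 1" by auto
        then show False using elim(1) by auto
      qed
      obtain m where m: "2 * ln (real n) \<le> 2 ^ m" "2 ^ m \<le> 4 * ln (real n)"
        using power_of_two_between[of "2 * ln (real n)"] elim(1) by auto
      define r where "r = (\<lambda>(i, j). if z $ i = z $ j then p else q)"
      define T where "T = (p - q) * n / 8"
      define bad where "bad = {f. noise_stat n (2 ^ m) z (noise_mat n r f) \<ge> T ^ (2 * 2 ^ m)}"
      define graph where "graph f = {{i, j} |i j. (i, j) \<in> vertex_pairs n \<and> f (i, j)}" for f
      let ?\<Omega> = "Pi_pmf (vertex_pairs n) False (\<lambda>e. bernoulli_pmf (r e))"
      let ?good = "{E. let A = adj_mat_with_diag n ((p - q) / 2) E;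
                  M = A - ((p + q) / 2) \<cdot>\<^sub>m offdiag_ones n;
                  At = (2 / (p - q)) \<cdot>\<^sub>m M
              in simple_sdp (max_diag_sdp n M) \<and>
                 primal_solution (max_diag_sdp n M) (self_outer z) \<and>
                 (\<exists>!y. dual_solution (max_diag_sdp n At) y) \<and>
                 (\<forall>y. dual_solution (max_diag_sdp n At) y \<longrightarrow>
                    eigval (n - 1) (- At - diag_of_vec y) > 1 / 4 * real n)}"
      have model: "block_model n z p q = map_pmf graph ?\<Omega>"
        unfolding block_model_def graph_def r_def
        by (intro arg_cong2[where f = map_pmf] arg_cong[where f = "Pi_pmf _ _"] ext) auto
      have good: "graph f \<in> ?good" if "f \<notin> bad" for f
      proof -
        define M where "M = adj_mat_with_diag n ((p - q) / 2) (graph f)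
            - ((p + q) / 2) \<cdot>\<^sub>m offdiag_ones n"
        have M: "M \<in> carrier_mat n n"
          by (auto simp: M_def adj_mat_with_diag_def offdiag_ones_def)
        let ?W = "noise_mat n r f"
        have T: "T \<ge> 0" "(p - q) / 2 * n - 2 * T = (p - q) * n / 4"
          using pq by (auto simp: T_def)
        have gap: "(p - q) / 2 * n - 2 * T > 0" unfolding T(2) using pq n2 by simp
        have small: "noise_stat n (2 ^ m) z ?W \<le> T ^ (2 * 2 ^ m)" using that by (auto simp: bad_def)
        have "certified_labels n M z ((p - q) / 2 * n - 2 * T)"
        proof (rule certified_labels_noise[OF M noise_mat_sym _ z z_sign n2])
          show "M $$ (i, j) = (p - q) / 2 * (z $ i * z $ j) + ?W $$ (i, j)" if "i < n" "j < n" for i j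
            unfolding M_def graph_def r_def by (rule adj_mat_signal_plus_noise[OF z_sign that])
        qed (use noise_stat_small[OF noise_mat_sym T(1) small] gap in auto)
        then have cert: "certified_labels n M z ((p - q) * n / 4)" unfolding T(2) .
        then have cert': "certified_labels n ((2 / (p - q)) \<cdot>\<^sub>m M) z (2 / (p - q) * ((p - q) * n / 4))"
          using pq by (intro certified_labels_smult) auto
        interpret M: certified_labels n M z "(p - q) * n / 4" by (rule cert)
        interpret At: certified_labels n "(2 / (p - q)) \<cdot>\<^sub>m M" z "2 / (p - q) * ((p - q) * n / 4)"
          by (rule cert')
        let ?At = "(2 / (p - q)) \<cdot>\<^sub>m M"
        have "1 / 4 * real n < 2 / (p - q) * ((p - q) * n / 4)" using pq n2 by simp
        also have "\<dots> \<le> eigval (n - 1) (- ?At - diag_of_vec (dual_candidate n ?At z))"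
          using At.second_smallest_eigenvalue by (simp add: candidate_slack_def)
        finally have "\<forall>y. dual_solution (max_diag_sdp n ?At) y \<longrightarrow>
            eigval (n - 1) (- ?At - diag_of_vec y) > 1 / 4 * real n"
          using At.dual_solution_unique by auto
        moreover have "\<exists>!y. dual_solution (max_diag_sdp n ?At) y"
          using At.simple by (simp add: simple_sdp_def)
        ultimately show ?thesis
          using M.simple M.X0_solution by (simp add: Let_def M_def)
      qed
      have "1 - \<epsilon> \<le> 1 - 2 / n"
        using elim(2) eps n2 by (simp add: field_simps)
      also have "\<dots> \<le> 1 - measure_pmf.prob ?\<Omega> bad"
        using noise_stat_tail[OF elim(1) z z_sign pq signal m] by (simp add: bad_def T_def r_def)
      also have "\<dots> = measure_pmf.prob ?\<Omega> (- bad)"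
        by (subst measure_pmf.prob_compl[of bad, simplified, symmetric]) (auto simp: Compl_eq_Diff_UNIV)
      also have "\<dots> \<le> measure_pmf.prob ?\<Omega> (graph -` ?good)"
        using good by (intro measure_pmf.finite_measure_mono) (auto simp del: mem_Collect_eq)
      also have "\<dots> = measure_pmf.prob (block_model n z p q) ?good"
        unfolding model by (rule measure_map_pmf[symmetric])
      finally show "1 - \<epsilon> \<le> measure_pmf.prob (block_model n z p q) ?good" .
    qed
  qed
qed auto

end
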